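(* For every sufficiently large constant $d$ there exist a constant $\gamma>0$ and a family $\{G_n\}_{n\in\mathbb{N}}$ of $d$-regular graphs, $G_n$ having $n$ vertices, such that every $G_n$ is $\gamma$-robustly self-ordered. Furthermore, these graphs can be taken to be expanders.
   Context: A graph $G=(V,E)$ is $\gamma$-robustly self-ordered if for every permutation $\pi:V\to V$, $|E\triangle\{\{\pi(u),\pi(v)\}:\{u,v\}\in E\}|\ge\gamma\cdot|\{v:\pi(v)\ne v\}|$. Expanders: there is a constant $\beta>0$ such that in every $G_n$, every vertex set $S$ with $|S|\le n/2$ has at least $\beta|S|$ vertices outside $S$ with a neighbour in $S$. Standing convention: a $d$-regular $n$-vertex graph is asserted only when $n>d$ and $nd$ is even (alternatively one vertex of degree $d-1$ is allowed).
   Formalization: Robust self-ordering is asserted only for n at least some n_0 depending on d, since it fails for small n (for n = d+1 the only d-regular graph is the complete graph); regularity and expansion hold for all n > d with nd even. *)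

theory Defs
  imports Complex_Main "HOL-Combinatorics.Permutations"
begin

definition simple_graph :: "'a set \<Rightarrow> 'a set set \<Rightarrow> bool" where
  "simple_graph V E \<longleftrightarrow>
     finite V \<and> (\<forall>e\<in>E. \<exists>u v. u \<in> V \<and> v \<in> V \<and> u \<noteq> v \<and> e = {u, v})"

definition degree :: "'a set set \<Rightarrow> 'a \<Rightarrow> nat" where
  "degree E v = card {e \<in> E. v \<in> e}"

definition regular_graph :: "nat \<Rightarrow> 'a set \<Rightarrow> 'a set set \<Rightarrow> bool" where
  "regular_graph d V E \<longleftrightarrow> simple_graph V E \<and> (\<forall>v\<in>V. degree E v = d)"

definition permuted_edges :: "('a \<Rightarrow> 'a) \<Rightarrow> 'a set set \<Rightarrow> 'a set set" where
  "permuted_edges \<pi> E = {{\<pi> u, \<pi> v} | u v. {u, v} \<in> E}"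

definition robustly_self_ordered :: "real \<Rightarrow> 'a set \<Rightarrow> 'a set set \<Rightarrow> bool" where
  "robustly_self_ordered \<gamma> V E \<longleftrightarrow>
     (\<forall>\<pi>. \<pi> permutes V \<longrightarrow>
        real (card (sym_diff E (permuted_edges \<pi> E))) \<ge> \<gamma> * real (card {v \<in> V. \<pi> v \<noteq> v}))"

definition vertex_expander :: "real \<Rightarrow> 'a set \<Rightarrow> 'a set set \<Rightarrow> bool" where
  "vertex_expander \<beta> V E \<longleftrightarrow>
     (\<forall>S. S \<subseteq> V \<and> real (card S) \<le> real (card V) / 2 \<longrightarrow>
        real (card {v \<in> V - S. \<exists>u\<in>S. {u, v} \<in> E}) \<ge> \<beta> * real (card S))"

end

theory Submission
  imports Defs "HOL-Library.FuncSet"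
begin

text \<open>
  For large \<open>n\<close> the graph is a random lift of the complete graph on \<open>d + 1\<close> vertices (with one
  part slightly larger than the others): it is simple and \<open>d\<close>-regular for every outcome, and a
  prescribed set of \<open>p\<close> pairs is contained in it with probability at most \<open>(3 / N)\<^sup>p\<close>, where
  \<open>N \<approx> n / (d + 1)\<close>. Everything else is a union bound.

  If \<open>\<pi>\<close> moves \<open>m\<close> points and fewer than \<open>m\<close> edges leave the edge set under \<open>\<pi>\<close>, then, as about
  \<open>d m / 2\<close> edges meet the moved points, there is a set \<open>J\<close> of \<open>2 m\<close> such edges, disjoint
  from \<open>\<pi> J\<close>, with \<open>J \<union> \<pi> J\<close> contained in the graph. There are at most \<open>n\<^sup>m\<close> choices for \<open>\<pi>\<close> and
  \<open>O(n)\<^sup>2\<^sup>m\<close> for \<open>J\<close>, each of probability \<open>O(d / n)\<^sup>4\<^sup>m\<close>, so such a \<open>\<pi>\<close> exists with small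
  probability.

  If a set \<open>S\<close> of at most \<open>n / 2\<close> vertices has fewer than \<open>|S| / 3\<close> outer neighbours, then either
  \<open>S\<close> with its neighbours is a small set that spans too many edges, which is again a containment
  event, or \<open>S\<close> and the remaining vertices are two sets of linear size without any edge between
  them. The latter has probability exponentially small in \<open>d |S|\<close>, which beats the \<open>4\<^sup>n\<close> choices
  of the two sets when \<open>d\<close> is large.

  The finitely many remaining values of \<open>n\<close> only need connected regular graphs.
\<close>

subsection \<open>Counting\<close>

text \<open>A weak Stirling bound: passing from \<open>k\<close> to \<open>Suc k\<close> multiplies
  the left side by (1 + 1/k)^k (k + 1) / 3, and (1 + 1/k)^k <= e <= 3. It is the source of the
  factors 3 in the later estimates.\<close>

lemma power_third_le_fact: "(real k / 3) ^ k \<le> fact k"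
proof (induction k)
  case (Suc k)
  have step: "(1 + 1 / real k) ^ k \<le> 3"
  proof (cases "k = 0")
    case False
    have "(1 + 1 / real k) ^ k \<le> exp 1"
      using exp_ge_one_plus_x_over_n_power_n[of k 1] False by simp
    then show ?thesis using exp_le by linarith
  qed simp
  have "real (Suc k) ^ k = (1 + 1 / real k) ^ k * real k ^ k"
    by (cases "k = 0") (simp_all add: field_simps flip: power_mult_distrib)
  then have "(real (Suc k) / 3) ^ Suc k
      = (1 + 1 / real k) ^ k * (real k / 3) ^ k * (real (Suc k) / 3)"
    by (simp add: power_divide mult_ac)
  also have "\<dots> \<le> 3 * fact k * (real (Suc k) / 3)"
    by (intro mult_mono step Suc.IH) auto
  finally show ?case by (simp add: algebra_simps)
qed simp

lemma binomial_le_power_div: "real (n choose k) \<le> (3 * real n / real k) ^ k"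
proof (cases "k = 0")
  case False
  then have pos: "0 < (real k / 3) ^ k" by simp
  have "real (n choose k) * (real k / 3) ^ k \<le> real (n choose k) * fact k"
    by (intro mult_left_mono power_third_le_fact) auto
  also have "\<dots> \<le> real n ^ k"
    using binomial_fact_pow[of n k] by (metis of_nat_fact of_nat_le_iff of_nat_mult of_nat_power)
  finally have "real (n choose k) \<le> real n ^ k / (real k / 3) ^ k"
    using pos by (simp add: pos_le_divide_eq)
  then show ?thesis using False by (simp add: power_divide power_mult_distrib field_simps)
qed simp

text \<open>The quotient of (n - p)! by n! is the probability that a uniform permutation takes
  \<open>p\<close> prescribed values. Its reciprocal is p! times a binomial coefficient, hence at
  least (p/3)^p (n/p)^p.\<close>

lemma fact_diff_le:
  assumes "p \<le> n"
  shows "(fact (n - p) :: real) \<le> fact n * (3 / real n) ^ p"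
proof (cases "p = 0")
  case False
  with assms have n: "0 < n" by simp
  have "(real n / 3) ^ p = (real p / 3) ^ p * (real n / real p) ^ p"
    using False by (simp flip: power_mult_distrib)
  also have "\<dots> \<le> fact p * real (n choose p)"
    by (intro mult_mono power_third_le_fact binomial_ge_n_over_k_pow_k assms) auto
  also have "\<dots> = fact n / fact (n - p)"
    using assms by (simp add: binomial_fact)
  finally have "(real n / 3) ^ p * fact (n - p) \<le> fact n"
    by (simp add: pos_le_divide_eq)
  then have "(real n / 3) ^ p * fact (n - p) * (3 / real n) ^ p \<le> fact n * (3 / real n) ^ p"
    by (intro mult_right_mono) auto
  moreover have "(real n / 3) ^ p * (3 / real n) ^ p = 1"
    using n by (simp flip: power_mult_distrib)
  ultimately show ?thesis by (simp add: algebra_simps)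
qed simp

text \<open>Composition with the inverse of \<open>\<tau>\<close> turns prescribed values into fixed
  points, so these permutations embed into those of \<open>S - R\<close>.\<close>

lemma card_permutes_prescribed:
  fixes S :: "'a set"
  assumes "finite S" "R \<subseteq> S" "\<tau> permutes S"
  shows "card {\<sigma>. \<sigma> permutes S \<and> (\<forall>a\<in>R. \<sigma> a = \<tau> a)} \<le> fact (card S - card R)"
proof -
  let ?A = "{\<sigma>. \<sigma> permutes S \<and> (\<forall>a\<in>R. \<sigma> a = \<tau> a)}"
  have "inv \<tau> \<circ> \<sigma> permutes S - R" if "\<sigma> \<in> ?A" for \<sigma>
  proof (rule permutes_superset[where S = S])
    show "inv \<tau> \<circ> \<sigma> permutes S"
      using that assms by (auto intro: permutes_compose permutes_inv)
    show "(inv \<tau> \<circ> \<sigma>) x = x" if "x \<in> S - (S - R)" for x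
      using that \<open>\<sigma> \<in> ?A\<close> permutes_inverses(2)[OF assms(3)] by auto
  qed
  moreover have "inj_on (\<lambda>\<sigma>. inv \<tau> \<circ> \<sigma>) ?A"
  proof (rule inj_on_inverseI)
    show "\<tau> \<circ> (inv \<tau> \<circ> \<sigma>) = \<sigma>" for \<sigma> :: "'a \<Rightarrow> 'a"
      using permutes_inverses(1)[OF assms(3)] by (auto simp: fun_eq_iff)
  qed
  ultimately have "card ?A \<le> card {p. p permutes S - R}"
    using assms by (intro card_inj_on_le[where f = "\<lambda>\<sigma>. inv \<tau> \<circ> \<sigma>"]) (auto intro: finite_permutations)
  also have "\<dots> = fact (card S - card R)"
    using assms by (intro card_permutations) (auto simp: card_Diff_subset finite_subset)
  finally show ?thesis .
qed

text \<open>The values on \<open>A\<close> are revealed one at a time. Each one avoids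
  \<open>B\<close> with probability 1 - |B|/|S| <= exp (- |B|/|S|), and since later values have
  fewer points left to choose from, keeping the original |S| in the denominator only weakens the
  bound.\<close>

lemma card_permutes_avoiding:
  fixes S :: "'a set"
  assumes "finite S" "A \<subseteq> S" "B \<subseteq> S"
  shows "real (card {\<sigma>. \<sigma> permutes S \<and> (\<forall>a\<in>A. \<sigma> a \<notin> B)})
      \<le> fact (card S) * exp (- (real (card A) * real (card B) / real (card S)))"
proof -
  have "finite A" using assms finite_subset by blast
  then show ?thesis using assms
  proof (induction A arbitrary: S B rule: finite_induct)
    case empty
    then show ?case by (simp add: card_permutations)
  next
    case (insert x A)
    define S' where "S' = S - {x}"
    have S: "S = insert x S'" "x \<notin> S'" "finite S'" "A \<subseteq> S'"
      using insert unfolding S'_def by auto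
    \<comment> \<open>Once the value at \<open>x\<close> is fixed to be \<open>b\<close>, composing
      with the transposition of \<open>x\<close> and \<open>b\<close> leaves a permutation of
      \<open>S'\<close>, whose forbidden set is \<open>C b\<close>. As \<open>b\<close> is not in
      \<open>B\<close>, the point \<open>x\<close> is not in \<open>C b\<close>.\<close>
    define C where "C b = transpose x b ` B" for b
    let ?P = "\<lambda>b. {q. q permutes S' \<and> (\<forall>a\<in>A. q a \<notin> C b)}"
    have finB: "finite B" using insert.prems finite_subset by blast
    have C: "C b \<subseteq> S' \<and> card (C b) = card B" if "b \<in> S - B" for b
    proof
      show "card (C b) = card B" unfolding C_def by (intro card_image) auto
      show "C b \<subseteq> S'" using that insert.prems S unfolding C_def by (auto simp: transpose_def)
    qed
    define s where "s = real (card S')"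
    define \<beta> where "\<beta> = real (card B)"
    define \<alpha> where "\<alpha> = real (card A)"
    have cS: "real (card S) = s + 1" unfolding s_def using S by simp
    have le: "\<beta> \<le> s + 1" 
      unfolding \<beta>_def cS[symmetric] using insert.prems by (simp add: card_mono)
    have sub: "{\<sigma>. \<sigma> permutes S \<and> (\<forall>a\<in>insert x A. \<sigma> a \<notin> B)}
        \<subseteq> (\<Union>b\<in>S - B. (\<lambda>q. transpose x b \<circ> q) ` ?P b)"
    proof
      fix \<sigma> assume "\<sigma> \<in> {\<sigma>. \<sigma> permutes S \<and> (\<forall>a\<in>insert x A. \<sigma> a \<notin> B)}"
      then have p: "\<sigma> permutes S" and av: "\<And>a. a \<in> insert x A \<Longrightarrow> \<sigma> a \<notin> B" by auto
      have b: "\<sigma> x \<in> S - B" using p av insert.prems by (auto simp: permutes_in_image)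
      have "transpose x (\<sigma> x) \<circ> \<sigma> permutes S'"
        using permutes_insert_lemma p S(1) by auto
      moreover have "(transpose x (\<sigma> x) \<circ> \<sigma>) a \<notin> C (\<sigma> x)" if "a \<in> A" for a
        using av that unfolding C_def by (auto simp: inj_image_mem_iff)
      moreover have "\<sigma> = transpose x (\<sigma> x) \<circ> (transpose x (\<sigma> x) \<circ> \<sigma>)"
        by (auto simp: fun_eq_iff)
      ultimately show "\<sigma> \<in> (\<Union>b\<in>S - B. (\<lambda>q. transpose x b \<circ> q) ` ?P b)"
        using b by blast
    qed
    have finP: "finite (?P b)" for b
      using finite_permutations[OF S(3)] by (rule rev_finite_subset) auto
    have "card {\<sigma>. \<sigma> permutes S \<and> (\<forall>a\<in>insert x A. \<sigma> a \<notin> B)}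
        \<le> card (\<Union>b\<in>S - B. (\<lambda>q. transpose x b \<circ> q) ` ?P b)"
      using finP insert.prems by (intro card_mono sub) auto
    also have "\<dots> \<le> (\<Sum>b\<in>S - B. card ((\<lambda>q. transpose x b \<circ> q) ` ?P b))"
      using insert.prems by (intro card_UN_le) auto
    also have "\<dots> \<le> (\<Sum>b\<in>S - B. card (?P b))"
      by (intro sum_mono card_image_le finP)
    finally have "real (card {\<sigma>. \<sigma> permutes S \<and> (\<forall>a\<in>insert x A. \<sigma> a \<notin> B)})
        \<le> (\<Sum>b\<in>S - B. real (card (?P b)))"
      unfolding of_nat_sum[symmetric] of_nat_le_iff .
    also have "\<dots> \<le> (\<Sum>b\<in>S - B. fact (card S') * exp (- (\<alpha> * \<beta> / s)))"
    proof (intro sum_mono)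
      fix b assume "b \<in> S - B"
      from insert.IH[of S' "C b"] C[OF this] S
      show "real (card (?P b)) \<le> fact (card S') * exp (- (\<alpha> * \<beta> / s))"
        by (simp add: \<alpha>_def \<beta>_def s_def)
    qed
    also have "\<dots> = (s + 1 - \<beta>) * fact (card S') * exp (- (\<alpha> * \<beta> / s))"
      using insert.prems finB le cS by (simp add: card_Diff_subset of_nat_diff card_mono \<beta>_def)
    also have "\<dots> \<le> ((s + 1) * exp (- \<beta> / (s + 1))) * fact (card S') * exp (- (\<alpha> * \<beta> / (s + 1)))"
    proof (intro mult_mono)
      have s0: "0 \<le> s" unfolding s_def by simp
      have "1 - \<beta> / (s + 1) \<le> exp (- \<beta> / (s + 1))"
        using exp_ge_add_one_self[of "- \<beta> / (s + 1)"] by simp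
      then have "(s + 1) * (1 - \<beta> / (s + 1)) \<le> (s + 1) * exp (- \<beta> / (s + 1))"
        using s0 by (intro mult_left_mono) auto
      then show "s + 1 - \<beta> \<le> (s + 1) * exp (- \<beta> / (s + 1))"
        using s0 by (simp add: right_diff_distrib)
      have "\<alpha> * \<beta> / (s + 1) \<le> \<alpha> * \<beta> / s"
      \<comment> \<open>For \<open>s = 0\<close> the quotient by \<open>s\<close> is 0 by
        convention; then \<open>A\<close> is empty, so the left side vanishes too.\<close>
      proof (cases "s = 0")
        case True
        then have "S' = {}" using S unfolding s_def by simp
        then have "\<alpha> = 0" using S unfolding \<alpha>_def by simp
        then show ?thesis by simp
      next
        case False
        then show ?thesis using s0 by (intro divide_left_mono) (auto simp: \<alpha>_def \<beta>_def)
      qed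
      then show "exp (- (\<alpha> * \<beta> / s)) \<le> exp (- (\<alpha> * \<beta> / (s + 1)))" by simp
    qed (auto simp: s_def)
    also have "\<dots> = fact (card S) * exp (- ((\<alpha> + 1) * \<beta> / (s + 1)))"
    proof -
      have "fact (card S) = (s + 1) * fact (card S')" unfolding s_def using S by simp
      moreover have "exp (- \<beta> / (s + 1)) * exp (- (\<alpha> * \<beta> / (s + 1))) = exp (- ((\<alpha> + 1) * \<beta> / (s + 1)))"
        by (simp flip: exp_add add: field_simps add_divide_distrib)
      ultimately show ?thesis by (simp add: algebra_simps)
    qed
    finally show ?case using insert.hyps cS by (simp add: \<alpha>_def \<beta>_def add.commute)
  qed
qed

text \<open>Groups a union bound over nonempty vertex sets by size; the resulting terms will be
  compared with the powers of 1/10.\<close>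

lemma sum_Pow_card:
  fixes h :: "nat \<Rightarrow> real"
  assumes "finite V"
  shows "(\<Sum>M\<in>Pow V - {{}}. h (card M)) = (\<Sum>m = 1..card V. real (card V choose m) * h m)"
proof -
  have "(\<Sum>M\<in>Pow V - {{}}. h (card M))
      = (\<Sum>m = 1..card V. \<Sum>M\<in>{M \<in> Pow V - {{}}. card M = m}. h (card M))"
  proof (rule sum.group[symmetric])
    show "card ` (Pow V - {{}}) \<subseteq> {1..card V}"
      using assms by (auto simp: card_mono Suc_le_eq card_gt_0_iff finite_subset)
  qed (use assms in auto)
  also have "\<dots> = (\<Sum>m = 1..card V. real (card V choose m) * h m)"
  proof (intro sum.cong refl)
    fix m assume "m \<in> {1..card V}"
    then have "{M \<in> Pow V - {{}}. card M = m} = {M. M \<subseteq> V \<and> card M = m}" by auto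
    then show "(\<Sum>M\<in>{M \<in> Pow V - {{}}. card M = m}. h (card M)) = real (card V choose m) * h m"
      using n_subsets[OF assms, of m] by simp
  qed
  finally show ?thesis .
qed

lemma sum_tenth_powers_le: "(\<Sum>m = 1..n. (1 / 10 :: real) ^ m) \<le> 1 / 9"
proof -
  have "(\<Sum>m = 1..n. (1 / 10 :: real) ^ m) = 1 / 9 - (1 / 10) ^ n / 9"
    by (induction n) auto
  then show ?thesis by simp
qed

text \<open>A maximal \<open>J\<close> disjoint from its image works: by maximality each point of
  \<open>X\<close> lies in \<open>J\<close>, lies in the image of \<open>J\<close>, or is mapped
  into \<open>J\<close>, and by injectivity each of these three sets has at most |J|
  elements.\<close>

lemma disjoint_from_image_third:
  assumes "finite X" and inj: "inj_on g X" and neq: "\<And>x. x \<in> X \<Longrightarrow> g x \<noteq> x"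
  shows "\<exists>J \<subseteq> X. J \<inter> g ` J = {} \<and> card X \<le> 3 * card J"
proof -
  define \<J> where "\<J> = {J \<in> Pow X. J \<inter> g ` J = {}}"
  have "finite \<J>" "{} \<in> \<J>" using assms(1) by (simp_all add: \<J>_def)
  from finite_has_maximal2[OF this]
  have "\<exists>J\<in>\<J>. \<forall>K\<in>\<J>. J \<subseteq> K \<longrightarrow> J = K" by simp
  then obtain J where J: "J \<in> \<J>" and max: "\<forall>K\<in>\<J>. J \<subseteq> K \<longrightarrow> J = K" ..
  have sub: "J \<subseteq> X" and disj: "J \<inter> g ` J = {}" using J by (simp_all add: \<J>_def)
  have finJ: "finite J" using sub assms(1) by (rule finite_subset)
  have "X \<subseteq> J \<union> g ` J \<union> {x \<in> X. g x \<in> J}"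
  proof
    fix e assume e: "e \<in> X"
    show "e \<in> J \<union> g ` J \<union> {x \<in> X. g x \<in> J}"
    proof (rule ccontr)
      assume no: "e \<notin> J \<union> g ` J \<union> {x \<in> X. g x \<in> J}"
      then have "insert e J \<in> \<J>"
        using sub disj e neq[OF e] by (auto simp: \<J>_def)
      with max no show False by auto
    qed
  qed
  then have "card X \<le> card (J \<union> g ` J \<union> {x \<in> X. g x \<in> J})"
    using finJ assms(1) by (intro card_mono) auto
  also have "\<dots> \<le> card J + card (g ` J) + card {x \<in> X. g x \<in> J}"
    by (meson add_le_mono card_Un_le le_trans order_refl)
  also have "card (g ` J) \<le> card J" using finJ by (rule card_image_le)
  also have "card {x \<in> X. g x \<in> J} \<le> card J"
    using finJ inj by (intro card_inj_on_le[where f = g]) (auto simp: inj_on_def)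
  finally show ?thesis using sub disj by (intro exI[of _ J]) auto
qed

subsection \<open>Degrees and incident edges\<close>

lemma simple_graph_finite:
  assumes "simple_graph V E"
  shows "finite E" and "E \<subseteq> {e. e \<subseteq> V \<and> card e = 2}"
proof -
  show *: "E \<subseteq> {e. e \<subseteq> V \<and> card e = 2}"
  proof
    fix e assume "e \<in> E"
    then obtain u v where "u \<in> V" "v \<in> V" "u \<noteq> v" "e = {u, v}"
      using assms unfolding simple_graph_def by blast
    then show "e \<in> {e. e \<subseteq> V \<and> card e = 2}" by simp
  qed
  then have "E \<subseteq> Pow V" by auto
  then show "finite E" using assms finite_subset unfolding simple_graph_def by blast
qed

lemma permuted_edges_eq_image:
  assumes "simple_graph V E"
  shows "permuted_edges \<pi> E = (\<lambda>e. \<pi> ` e) ` E"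
proof
  show "permuted_edges \<pi> E \<subseteq> (\<lambda>e. \<pi> ` e) ` E"
    unfolding permuted_edges_def by (clarify, rule rev_image_eqI) auto
  show "(\<lambda>e. \<pi> ` e) ` E \<subseteq> permuted_edges \<pi> E"
  proof
    fix x assume "x \<in> (\<lambda>e. \<pi> ` e) ` E"
    then obtain e where e: "e \<in> E" "x = \<pi> ` e" by auto
    then obtain u v where "e = {u, v}" using assms unfolding simple_graph_def by blast
    with e show "x \<in> permuted_edges \<pi> E" unfolding permuted_edges_def by auto
  qed
qed

lemma sum_degree_eq:
  assumes "finite E" "finite S"
  shows "(\<Sum>v\<in>S. degree E v) = (\<Sum>e\<in>{e \<in> E. e \<inter> S \<noteq> {}}. card (e \<inter> S))"
proof -
  have "(\<Sum>v\<in>S. degree E v) = (\<Sum>v\<in>S. card {e \<in> {e \<in> E. e \<inter> S \<noteq> {}}. v \<in> e})"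
    unfolding degree_def by (intro sum.cong refl arg_cong[where f = card]) auto
  also have "\<dots> = (\<Sum>e\<in>{e \<in> E. e \<inter> S \<noteq> {}}. card (e \<inter> S))"
    using assms by (intro sum_multicount_gen) (auto intro!: arg_cong[where f = card])
  finally show ?thesis .
qed

lemma card_incident_ge:
  assumes E: "simple_graph V E" and S: "finite S" and deg: "\<And>v. v \<in> S \<Longrightarrow> degree E v = d"
  shows "d * card S \<le> 2 * card {e \<in> E. e \<inter> S \<noteq> {}}"
proof -
  note E' = simple_graph_finite[OF E]
  have "d * card S = (\<Sum>v\<in>S. degree E v)" using deg by simp
  also have "\<dots> = (\<Sum>e\<in>{e \<in> E. e \<inter> S \<noteq> {}}. card (e \<inter> S))"
    by (rule sum_degree_eq[OF E'(1) S])
  also have "\<dots> \<le> (\<Sum>e\<in>{e \<in> E. e \<inter> S \<noteq> {}}. 2)"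
  proof (intro sum_mono)
    fix e assume "e \<in> {e \<in> E. e \<inter> S \<noteq> {}}"
    then have "card e = 2" using E'(2) by auto
    then show "card (e \<inter> S) \<le> 2"
      using card_mono[of e "e \<inter> S"] by (metis Int_lower1 card.infinite zero_neq_numeral)
  qed
  finally show ?thesis by simp
qed

lemma card_incident_le:
  assumes E: "finite E" and S: "finite S" and deg: "\<And>v. v \<in> S \<Longrightarrow> degree E v \<le> k"
  shows "card {e \<in> E. e \<inter> S \<noteq> {}} \<le> k * card S"
proof -
  have "card {e \<in> E. e \<inter> S \<noteq> {}} \<le> (\<Sum>e\<in>{e \<in> E. e \<inter> S \<noteq> {}}. card (e \<inter> S))"
  proof -
    have "(\<Sum>e\<in>{e \<in> E. e \<inter> S \<noteq> {}}. 1) \<le> (\<Sum>e\<in>{e \<in> E. e \<inter> S \<noteq> {}}. card (e \<inter> S))"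
      using S by (intro sum_mono) (auto simp: Suc_le_eq card_gt_0_iff)
    then show ?thesis by simp
  qed
  also have "\<dots> = (\<Sum>v\<in>S. degree E v)" by (rule sum_degree_eq[OF E S, symmetric])
  also have "\<dots> \<le> (\<Sum>v\<in>S. k)" by (intro sum_mono deg)
  finally show ?thesis by (simp add: mult.commute)
qed

subsection \<open>Regular graphs from random matchings\<close>

text \<open>For each class \<open>c \<in> I\<close> an independent uniform permutation \<open>\<omega> c\<close> of \<open>{..<N}\<close> matches
  \<open>f c a\<close> with \<open>g c (\<omega> c a)\<close>; the edges in \<open>F\<close> are always present. By \<open>pair_inj\<close> and
  \<open>pair_notin_F\<close> no edge can arise twice, so that every outcome is simple and regular.\<close>

locale matching_model =
  fixes V :: "'a set" and I :: "'c set" and N d :: nat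
    and f g :: "'c \<Rightarrow> nat \<Rightarrow> 'a" and F :: "'a set set"
  assumes finite_I: "finite I" and N_pos: "0 < N"
    and f_in: "\<And>c a. c \<in> I \<Longrightarrow> a < N \<Longrightarrow> f c a \<in> V"
    and g_in: "\<And>c b. c \<in> I \<Longrightarrow> b < N \<Longrightarrow> g c b \<in> V"
    and f_neq_g: "\<And>c a b. c \<in> I \<Longrightarrow> a < N \<Longrightarrow> b < N \<Longrightarrow> f c a \<noteq> g c b"
    and pair_inj: "inj_on (\<lambda>(c, a, b). {f c a, g c b}) (I \<times> {..<N} \<times> {..<N})"
    and pair_notin_F: "\<And>c a b. c \<in> I \<Longrightarrow> a < N \<Longrightarrow> b < N \<Longrightarrow> {f c a, g c b} \<notin> F"
    and F_simple: "simple_graph V F"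
    and F_degree: "\<And>v. v \<in> V \<Longrightarrow> degree F v \<le> 1"
    and class_count: "\<And>v. v \<in> V \<Longrightarrow>
      card {c \<in> I. v \<in> f c ` {..<N} \<union> g c ` {..<N}} + degree F v = d"
    and uncovered: "\<And>x. x \<in> V \<Longrightarrow>
      card {y \<in> V. \<forall>c\<in>I. \<forall>a<N. \<forall>b<N. {x, y} \<noteq> {f c a, g c b}} \<le> 3 * N"
    and card_V_ge: "(d + 1) * N \<le> card V"
    and card_V_le: "card V \<le> (d + 2) * N"
begin

text \<open>Probabilities are handled by counting: an event is a subset of \<open>\<Omega>\<close>,
  compared with \<open>card \<Omega>\<close>. Outcomes are extensional outside \<open>I\<close>,
  which keeps \<open>\<Omega>\<close> finite.\<close>

definition \<Omega> :: "('c \<Rightarrow> nat \<Rightarrow> nat) set" where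
  "\<Omega> = (\<Pi>\<^sub>E c\<in>I. {\<sigma>. \<sigma> permutes {..<N}})"

definition matched :: "('c \<Rightarrow> nat \<Rightarrow> nat) \<Rightarrow> 'a set set" where
  "matched \<omega> = (\<lambda>(c, a). {f c a, g c (\<omega> c a)}) ` (I \<times> {..<N})"

definition edges :: "('c \<Rightarrow> nat \<Rightarrow> nat) \<Rightarrow> 'a set set" where
  "edges \<omega> = F \<union> matched \<omega>"

lemma finite_V: "finite V"
  using F_simple unfolding simple_graph_def by simp

lemma finite_F: "finite F"
  by (rule simple_graph_finite(1)[OF F_simple])

lemma finite_\<Omega>: "finite \<Omega>"
  unfolding \<Omega>_def using finite_I by (intro finite_PiE finite_permutations) auto

lemma card_\<Omega>: "card \<Omega> = (\<Prod>c\<in>I. fact N)"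
  unfolding \<Omega>_def by (simp add: card_PiE[OF finite_I] card_permutations)

lemma card_\<Omega>_pos: "0 < card \<Omega>"
  unfolding card_\<Omega> by simp

lemma \<Omega>_permutes: "\<omega> \<in> \<Omega> \<Longrightarrow> c \<in> I \<Longrightarrow> \<omega> c permutes {..<N}"
  unfolding \<Omega>_def by auto

lemma \<Omega>_less [simp]: "\<omega> \<in> \<Omega> \<Longrightarrow> c \<in> I \<Longrightarrow> \<omega> c a < N \<longleftrightarrow> a < N"
  using permutes_in_image[OF \<Omega>_permutes, of \<omega> c a] by simp

lemma pair_eqD:
  assumes "{f c a, g c b} = {f c' a', g c' b'}"
    and "c \<in> I" "a < N" "b < N" "c' \<in> I" "a' < N" "b' < N"
  shows "c = c'" "a = a'" "b = b'"
proof -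
  have "(c, a, b) = (c', a', b')"
    by (rule inj_onD[OF pair_inj]) (simp_all only: prod.case assms(1) mem_Times_iff lessThan_iff
        fst_conv snd_conv assms(2-) simp_thms)
  then show "c = c'" "a = a'" "b = b'" by simp_all
qed

lemma f_inj:
  assumes "f c a = f c a'" and *: "c \<in> I" "a < N" "a' < N"
  shows "a = a'"
proof -
  have "{f c a, g c 0} = {f c a', g c 0}" using assms(1) by simp
  then show ?thesis by (rule pair_eqD(2)) (use * N_pos in auto)
qed

lemma g_inj:
  assumes "g c b = g c b'" and *: "c \<in> I" "b < N" "b' < N"
  shows "b = b'"
proof -
  have "{f c 0, g c b} = {f c 0, g c b'}" using assms(1) by simp
  then show ?thesis by (rule pair_eqD(3)) (use * N_pos in auto)
qed

lemma matched_disjoint_F: "\<omega> \<in> \<Omega> \<Longrightarrow> matched \<omega> \<inter> F = {}"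
  unfolding matched_def using pair_notin_F by auto

lemma matched_inj:
  assumes "\<omega> \<in> \<Omega>"
  shows "inj_on (\<lambda>(c, a). {f c a, g c (\<omega> c a)}) (I \<times> {..<N})"
proof (rule inj_onI, clarsimp)
  fix c a c' a'
  assume eq: "{f c a, g c (\<omega> c a)} = {f c' a', g c' (\<omega> c' a')}"
    and *: "c \<in> I" "a < N" "c' \<in> I" "a' < N"
  show "c = c' \<and> a = a'" using pair_eqD[OF eq] * assms by simp
qed

lemma edges_simple:
  assumes "\<omega> \<in> \<Omega>"
  shows "simple_graph V (edges \<omega>)"
  unfolding simple_graph_def
proof (intro conjI ballI finite_V)
  fix e assume "e \<in> edges \<omega>"
  then consider "e \<in> F" | c a where "c \<in> I" "a < N" "e = {f c a, g c (\<omega> c a)}"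
    unfolding edges_def matched_def by auto
  then show "\<exists>u v. u \<in> V \<and> v \<in> V \<and> u \<noteq> v \<and> e = {u, v}"
  proof cases
    case 1
    then show ?thesis using F_simple unfolding simple_graph_def by blast
  next
    case (2 c a)
    with assms have "\<omega> c a < N" by simp
    with 2 show ?thesis using f_in g_in f_neq_g by blast
  qed
qed

text \<open>A class whose ranges contain \<open>v\<close> contributes exactly one edge at
  \<open>v\<close>, whatever the outcome: \<open>f c\<close> and \<open>g c\<close> are injective
  with disjoint ranges, and \<open>\<omega> c\<close> is a bijection.\<close>

lemma degree_matched:
  assumes "\<omega> \<in> \<Omega>"
  shows "degree (matched \<omega>) v = card {c \<in> I. v \<in> f c ` {..<N} \<union> g c ` {..<N}}"
proof -
  let ?A = "{p \<in> I \<times> {..<N}. v \<in> (\<lambda>(c, a). {f c a, g c (\<omega> c a)}) p}"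
  have "{e \<in> matched \<omega>. v \<in> e} = (\<lambda>(c, a). {f c a, g c (\<omega> c a)}) ` ?A"
    unfolding matched_def by auto
  moreover have "inj_on (\<lambda>(c, a). {f c a, g c (\<omega> c a)}) ?A"
    using matched_inj[OF assms] by (rule inj_on_subset) auto
  ultimately have "degree (matched \<omega>) v = card ?A"
    unfolding degree_def by (simp only: card_image)
  also have "card ?A = card (fst ` ?A)"
  proof (intro card_image[symmetric] inj_onI)
    fix p q assume p: "p \<in> ?A" and q: "q \<in> ?A" and eq: "fst p = fst q"
    obtain c a where pa: "p = (c, a)" by (cases p)
    obtain b where qb: "q = (c, b)" using eq pa by (cases q) auto
    have I: "c \<in> I" "a < N" "b < N" using p q pa qb by auto
    have "v = f c a \<or> v = g c (\<omega> c a)" "v = f c b \<or> v = g c (\<omega> c b)"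
      using p q pa qb by auto
    then have "f c a = f c b \<or> g c (\<omega> c a) = g c (\<omega> c b)"
      using f_neq_g[of c a "\<omega> c b"] f_neq_g[of c b "\<omega> c a"] I assms by auto
    then have "a = b"
      using f_inj[of c a b] g_inj[of c "\<omega> c a" "\<omega> c b"] I assms
        permutes_inj[OF \<Omega>_permutes[OF assms I(1)]] by (auto dest: injD)
    then show "p = q" using pa qb by simp
  qed
  also have "fst ` ?A = {c \<in> I. v \<in> f c ` {..<N} \<union> g c ` {..<N}}"
  proof (intro set_eqI iffI)
    fix c assume "c \<in> fst ` ?A"
    then show "c \<in> {c \<in> I. v \<in> f c ` {..<N} \<union> g c ` {..<N}}" using assms by auto
  next
    fix c assume "c \<in> {c \<in> I. v \<in> f c ` {..<N} \<union> g c ` {..<N}}"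
    then have c: "c \<in> I" and v: "v \<in> f c ` {..<N} \<union> g c ` {..<N}" by auto
    from v have "\<exists>a<N. v \<in> {f c a, g c (\<omega> c a)}"
    proof
      assume "v \<in> g c ` {..<N}"
      then obtain b where b: "b < N" "v = g c b" by auto
      then have "\<exists>a. \<omega> c a = b" using permutes_surj[OF \<Omega>_permutes[OF assms c]] by (metis surjD)
      with b show ?thesis using assms c by auto
    qed auto
    then obtain a where "a < N" "v \<in> {f c a, g c (\<omega> c a)}" by auto
    then have "(c, a) \<in> ?A" using c by auto
    then show "c \<in> fst ` ?A" by force
  qed
  finally show ?thesis .
qed

lemma edges_regular:
  assumes "\<omega> \<in> \<Omega>"
  shows "regular_graph d V (edges \<omega>)"
  unfolding regular_graph_def
proof (intro conjI ballI edges_simple[OF assms])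
  fix v assume v: "v \<in> V"
  have fin: "finite (matched \<omega>)" unfolding matched_def using finite_I by simp
  have "{e \<in> edges \<omega>. v \<in> e} = {e \<in> F. v \<in> e} \<union> {e \<in> matched \<omega>. v \<in> e}"
    unfolding edges_def by auto
  then have "degree (edges \<omega>) v = degree F v + degree (matched \<omega>) v"
    unfolding degree_def using matched_disjoint_F[OF assms] finite_F fin
    by (simp, subst card_Un_disjoint) auto
  then show "degree (edges \<omega>) v = d"
    using class_count[OF v] degree_matched[OF assms] by simp
qed

text \<open>By \<open>pair_inj\<close> a pair outside \<open>F\<close> can arise from only one class
  and one prescribed value there. All outcomes containing \<open>P\<close> therefore agree with any
  single such outcome \<open>\<tau>\<close> on the sets \<open>R c\<close>, which have |P| elements
  in total, and independence of the classes gives a product.\<close>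

lemma card_containing_le:
  assumes fin: "finite P" and disj: "P \<inter> F = {}"
  shows "real (card {\<omega> \<in> \<Omega>. P \<subseteq> edges \<omega>}) \<le> real (card \<Omega>) * (3 / real N) ^ card P"
proof (cases "{\<omega> \<in> \<Omega>. P \<subseteq> edges \<omega>} = {}")
  case True
  then show ?thesis by (simp only: True) simp
next
  case False
  then obtain \<tau> where \<tau>: "\<tau> \<in> \<Omega>" "P \<subseteq> matched \<tau>" using disj by (auto simp: edges_def)
  define R where "R c = {a. a < N \<and> {f c a, g c (\<tau> c a)} \<in> P}" for c
  have finR: "finite (R c)" and R_sub: "R c \<subseteq> {..<N}" for c unfolding R_def by auto
  have cardP: "card P = (\<Sum>c\<in>I. card (R c))"
  proof -
    have "P = (\<lambda>(c, a). {f c a, g c (\<tau> c a)}) ` Sigma I R"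
      using \<tau>(2) unfolding R_def matched_def by auto
    moreover have "inj_on (\<lambda>(c, a). {f c a, g c (\<tau> c a)}) (Sigma I R)"
      using matched_inj[OF \<tau>(1)] by (rule inj_on_subset) (auto simp: R_def)
    ultimately have "card P = card (Sigma I R)" by (simp add: card_image)
    then show ?thesis using finite_I finR by simp
  qed
  let ?Q = "\<lambda>c. {\<sigma>. \<sigma> permutes {..<N} \<and> (\<forall>a\<in>R c. \<sigma> a = \<tau> c a)}"
  have finQ: "finite (?Q c)" for c
    using finite_permutations[of "{..<N}"] by (rule rev_finite_subset) auto
  have "{\<omega> \<in> \<Omega>. P \<subseteq> edges \<omega>} \<subseteq> PiE I ?Q"
  proof (intro subsetI PiE_I)
    fix \<omega> c assume "\<omega> \<in> {\<omega> \<in> \<Omega>. P \<subseteq> edges \<omega>}"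
    then have \<omega>: "\<omega> \<in> \<Omega>" "P \<subseteq> matched \<omega>" using disj by (auto simp: edges_def)
    show "\<omega> c = undefined" if "c \<notin> I" using \<omega> that unfolding \<Omega>_def by auto
    assume c: "c \<in> I"
    have "\<omega> c a = \<tau> c a" if "a \<in> R c" for a
    proof -
      have a: "a < N" "{f c a, g c (\<tau> c a)} \<in> matched \<omega>" using that \<omega>(2) by (auto simp: R_def)
      then obtain c' a' where eq: "{f c a, g c (\<tau> c a)} = {f c' a', g c' (\<omega> c' a')}"
        and I: "c' \<in> I" "a' < N" unfolding matched_def by auto
      have less: "\<tau> c a < N" "\<omega> c' a' < N" using \<tau> \<omega> c a I by simp_all
      note e = pair_eqD[OF eq c a(1) less(1) I less(2)]
      show ?thesis using e by simp
    qed
    then show "\<omega> c \<in> ?Q c" using \<Omega>_permutes[OF \<omega>(1) c] by simp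
  qed
  then have "card {\<omega> \<in> \<Omega>. P \<subseteq> edges \<omega>} \<le> (\<Prod>c\<in>I. card (?Q c))"
    by (rule card_mono[OF finite_PiE[OF finite_I finQ], unfolded card_PiE[OF finite_I]])
  then have "real (card {\<omega> \<in> \<Omega>. P \<subseteq> edges \<omega>}) \<le> (\<Prod>c\<in>I. real (card (?Q c)))"
    unfolding of_nat_prod[symmetric] of_nat_le_iff .
  also have "\<dots> \<le> (\<Prod>c\<in>I. fact N * (3 / real N) ^ card (R c))"
  proof (intro prod_mono conjI)
    fix c assume "c \<in> I"
    then have "card (?Q c) \<le> fact (N - card (R c))"
      using card_permutes_prescribed[of "{..<N}" "R c" "\<tau> c"] R_sub \<Omega>_permutes[OF \<tau>(1)] by simp
    then have "real (card (?Q c)) \<le> real (fact (N - card (R c)))"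
      by (rule of_nat_mono)
    then have "real (card (?Q c)) \<le> fact (N - card (R c))" by simp
    also have "\<dots> \<le> fact N * (3 / real N) ^ card (R c)"
      using card_mono[OF _ R_sub, of c] by (intro fact_diff_le) simp
    finally show "real (card (?Q c)) \<le> fact N * (3 / real N) ^ card (R c)" .
  qed simp
  also have "\<dots> = real (card \<Omega>) * (3 / real N) ^ card P"
    unfolding prod.distrib cardP card_\<Omega> by (simp add: power_sum)
  finally show ?thesis .
qed

text \<open>In each class the permutation has to avoid two rectangles, according to which of
  \<open>S\<close> and \<open>Q\<close> supplies the \<open>f\<close> end. Only the larger rectangle
  is used, which costs the factor 2 in the exponent. By \<open>uncovered\<close>, each vertex of
  \<open>S\<close> loses at most 3 N of its |Q| potential partners.\<close>

lemma card_no_edges_between_le: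
  assumes S: "S \<subseteq> V" and Q: "Q \<subseteq> V"
  shows "real (card {\<omega> \<in> \<Omega>. \<forall>x\<in>S. \<forall>y\<in>Q. {x, y} \<notin> edges \<omega>})
    \<le> real (card \<Omega>) * exp (- (real (card S) * (real (card Q) - 3 * real N) / (2 * real N)))"
proof -
  define A where "A T c = {a. a < N \<and> f c a \<in> T}" for T c
  define B where "B T c = {b. b < N \<and> g c b \<in> T}" for T c
  have fin: "finite (A T c)" "finite (B T c)" and sub: "A T c \<subseteq> {..<N}" "B T c \<subseteq> {..<N}" for T c
    unfolding A_def B_def by auto
  have finS: "finite S" and finQ: "finite Q" using S Q finite_V finite_subset by blast+
  define w where "w c = card (A S c) * card (B Q c) + card (A Q c) * card (B S c)" for c
  define cov where "cov x y \<longleftrightarrow> (\<exists>c\<in>I. \<exists>a<N. \<exists>b<N. {x, y} = {f c a, g c b})" for x y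
  have w_ge: "real (card S) * (real (card Q) - 3 * real N) \<le> (\<Sum>c\<in>I. real (w c))"
  proof -
    have "real (card S) * (real (card Q) - 3 * real N) = (\<Sum>x\<in>S. real (card Q) - 3 * real N)" by simp
    also have "\<dots> \<le> (\<Sum>x\<in>S. real (card {y \<in> Q. cov x y}))"
    proof (intro sum_mono)
      fix x assume "x \<in> S"
      have "Q \<subseteq> {y \<in> Q. cov x y} \<union> {y \<in> V. \<forall>c\<in>I. \<forall>a<N. \<forall>b<N. {x, y} \<noteq> {f c a, g c b}}"
        using Q unfolding cov_def by auto
      then have "card Q \<le> card ({y \<in> Q. cov x y} \<union> {y \<in> V. \<forall>c\<in>I. \<forall>a<N. \<forall>b<N. {x, y} \<noteq> {f c a, g c b}})"
        using finQ finite_V by (intro card_mono) auto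
      also have "\<dots> \<le> card {y \<in> Q. cov x y} + card {y \<in> V. \<forall>c\<in>I. \<forall>a<N. \<forall>b<N. {x, y} \<noteq> {f c a, g c b}}"
        by (rule card_Un_le)
      also have "\<dots> \<le> card {y \<in> Q. cov x y} + 3 * N"
        using uncovered S \<open>x \<in> S\<close> by (intro add_left_mono) auto
      finally show "real (card Q) - 3 * real N \<le> real (card {y \<in> Q. cov x y})" by simp
    qed
    also have "\<dots> = real (card (SIGMA x:S. {y \<in> Q. cov x y}))"
      using finS finQ by simp
    also have "\<dots> \<le> real (\<Sum>c\<in>I. w c)"
    proof -
      \<comment> \<open>The two orientations of a pair: \<open>?L\<close> has the vertex of
        \<open>S\<close> at the \<open>f\<close> end, \<open>?R\<close> has it at the
        \<open>g\<close> end.\<close>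
      let ?L = "SIGMA c:I. A S c \<times> B Q c" and ?R = "SIGMA c:I. A Q c \<times> B S c"
      have finLR: "finite ?L" "finite ?R" using finite_I fin by auto
      have "(SIGMA x:S. {y \<in> Q. cov x y})
          \<subseteq> (\<lambda>(c, a, b). (f c a, g c b)) ` ?L \<union> (\<lambda>(c, a, b). (g c b, f c a)) ` ?R"
      proof clarify
        fix x y assume xy: "x \<in> S" "y \<in> Q" "cov x y"
          and no: "(x, y) \<notin> (\<lambda>(c, a, b). (g c b, f c a)) ` ?R"
        then obtain c a b where c: "c \<in> I" "a < N" "b < N" "{x, y} = {f c a, g c b}"
          unfolding cov_def by auto
        then have "x = f c a \<and> y = g c b \<or> x = g c b \<and> y = f c a" by (auto simp: doubleton_eq_iff)
        then show "(x, y) \<in> (\<lambda>(c, a, b). (f c a, g c b)) ` ?L"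
        proof
          assume "x = f c a \<and> y = g c b"
          then show ?thesis using xy c by (force simp: A_def B_def)
        next
          assume "x = g c b \<and> y = f c a"
          then have "(x, y) \<in> (\<lambda>(c, a, b). (g c b, f c a)) ` ?R"
            using xy c by (force simp: A_def B_def)
          with no show ?thesis by contradiction
        qed
      qed
      then have "card (SIGMA x:S. {y \<in> Q. cov x y})
          \<le> card ((\<lambda>(c, a, b). (f c a, g c b)) ` ?L \<union> (\<lambda>(c, a, b). (g c b, f c a)) ` ?R)"
        using finLR by (intro card_mono) auto
      also have "\<dots> \<le> card ?L + card ?R"
        using finLR by (intro order_trans[OF card_Un_le] add_mono card_image_le)
      also have "\<dots> = (\<Sum>c\<in>I. w c)"
        unfolding w_def using finite_I fin by (simp add: sum.distrib card_cartesian_product)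
      finally show ?thesis unfolding of_nat_le_iff .
    qed
    finally show ?thesis by simp
  qed
  let ?Q = "\<lambda>c. {\<sigma>. \<sigma> permutes {..<N} \<and> (\<forall>a\<in>A S c. \<sigma> a \<notin> B Q c) \<and> (\<forall>a\<in>A Q c. \<sigma> a \<notin> B S c)}"
  have finP: "finite {\<sigma>. \<sigma> permutes {..<N} \<and> P \<sigma>}" for P
    using finite_permutations[of "{..<N}"] by (rule rev_finite_subset) auto
  have finQ': "finite (?Q c)" for c by (rule finP)
  have "{\<omega> \<in> \<Omega>. \<forall>x\<in>S. \<forall>y\<in>Q. {x, y} \<notin> edges \<omega>} \<subseteq> PiE I ?Q"
  proof (intro subsetI PiE_I)
    fix \<omega> c assume \<omega>: "\<omega> \<in> {\<omega> \<in> \<Omega>. \<forall>x\<in>S. \<forall>y\<in>Q. {x, y} \<notin> edges \<omega>}"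
    show "\<omega> c = undefined" if "c \<notin> I" using \<omega> that unfolding \<Omega>_def by auto
    assume c: "c \<in> I"
    have "{f c a, g c (\<omega> c a)} \<in> edges \<omega>" "{g c (\<omega> c a), f c a} \<in> edges \<omega>" if "a < N" for a
      using that c unfolding edges_def matched_def by (auto simp: insert_commute)
    then show "\<omega> c \<in> ?Q c"
      using \<omega> \<Omega>_permutes[of \<omega> c] c unfolding A_def B_def by blast
  qed
  then have "card {\<omega> \<in> \<Omega>. \<forall>x\<in>S. \<forall>y\<in>Q. {x, y} \<notin> edges \<omega>} \<le> (\<Prod>c\<in>I. card (?Q c))"
    by (rule card_mono[OF finite_PiE[OF finite_I finQ'], unfolded card_PiE[OF finite_I]])
  then have "real (card {\<omega> \<in> \<Omega>. \<forall>x\<in>S. \<forall>y\<in>Q. {x, y} \<notin> edges \<omega>}) \<le> (\<Prod>c\<in>I. real (card (?Q c)))"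
    unfolding of_nat_prod[symmetric] of_nat_le_iff .
  also have "\<dots> \<le> (\<Prod>c\<in>I. fact N * exp (- (real (w c) / (2 * real N))))"
  proof (intro prod_mono conjI)
    fix c
    have one: "real (card (?Q c)) \<le> fact N * exp (- (real (card (A T c) * card (B U c)) / real N))"
      if "T = S \<and> U = Q \<or> T = Q \<and> U = S" for T U
    proof -
      have "card (?Q c) \<le> card {\<sigma>. \<sigma> permutes {..<N} \<and> (\<forall>a\<in>A T c. \<sigma> a \<notin> B U c)}"
        using that by (intro card_mono finP) auto
      then show ?thesis
        using card_permutes_avoiding[of "{..<N}" "A T c" "B U c"] sub by simp
    qed
    \<comment> \<open>The maximum of \<open>p\<close> and \<open>q\<close> is at least their mean,
      which is half of \<open>w c\<close>.\<close>
    define p q where "p = card (A S c) * card (B Q c)" and "q = card (A Q c) * card (B S c)"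
    have "real (w c) / (2 * real N) \<le> real (max p q) / real N"
      using N_pos unfolding w_def p_def[symmetric] q_def[symmetric]
      by (simp add: field_simps max_def)
    then have "exp (- (real (max p q) / real N)) \<le> exp (- (real (w c) / (2 * real N)))" by simp
    moreover have "real (card (?Q c)) \<le> fact N * exp (- (real (max p q) / real N))"
      using one[of S Q] one[of Q S] unfolding p_def[symmetric] q_def[symmetric]
      by (simp add: max_def)
    ultimately show "real (card (?Q c)) \<le> fact N * exp (- (real (w c) / (2 * real N)))"
      by (meson fact_ge_zero mult_left_mono order_trans)
  qed simp
  also have "\<dots> = real (card \<Omega>) * exp (- ((\<Sum>c\<in>I. real (w c)) / (2 * real N)))"
    unfolding prod.distrib card_\<Omega>
    by (simp add: exp_sum[OF finite_I, symmetric] sum_negf sum_divide_distrib)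
  also have "\<dots> \<le> real (card \<Omega>) * exp (- (real (card S) * (real (card Q) - 3 * real N) / (2 * real N)))"
    using w_ge N_pos by (intro mult_left_mono) (auto simp: divide_right_mono)
  finally show ?thesis .
qed

end

subsection \<open>Robustness and expansion of the random graph\<close>

context matching_model
begin

lemma three_over_N_le: "3 / real N \<le> 3 * (real d + 2) / real (card V)"
proof -
  have "0 < card V" using card_V_ge N_pos by (metis add_gr_0 le_zero_eq mult_is_0 not_gr_zero zero_neq_one add_is_0)
  moreover have "real (card V) \<le> (real d + 2) * real N"
    using card_V_le by (metis of_nat_add of_nat_le_iff of_nat_mult of_nat_numeral)
  ultimately show ?thesis using N_pos by (simp add: field_simps)
qed

text \<open>Encoded as an image of a product to make the bound |M| |V| immediate; the singletons
  coming from u = v do no harm.\<close>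

definition touching_pairs :: "'a set \<Rightarrow> 'a set set" where
  "touching_pairs M = (\<lambda>(u, v). {u, v}) ` (M \<times> V)"

lemma card_touching_pairs_le:
  assumes "M \<subseteq> V"
  shows "finite (touching_pairs M)" "card (touching_pairs M) \<le> card M * card V"
proof -
  have fin: "finite (M \<times> V)" using assms finite_V finite_subset by blast
  then show "finite (touching_pairs M)" unfolding touching_pairs_def by (rule finite_imageI)
  show "card (touching_pairs M) \<le> card M * card V"
    using card_image_le[OF fin] unfolding touching_pairs_def card_cartesian_product .
qed

text \<open>Each edge \<open>e \<in> J\<close> forces the further edge \<open>\<pi> ` e\<close>. The forced edges cost a factor
  \<open>O(1 / n)\<close> each in probability, and since there are \<open>2 m\<close> of them for \<open>m\<close> moved points, they
  outweigh the \<open>n\<^sup>m\<close> choices of \<open>\<pi>\<close>.\<close>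

lemma almost_invariant_witness:
  assumes \<omega>: "\<omega> \<in> \<Omega>" and d: "20 \<le> d" and \<pi>: "\<pi> permutes V"
    and M: "M = {v \<in> V. \<pi> v \<noteq> v}"
    and few: "card (sym_diff (edges \<omega>) (permuted_edges \<pi> (edges \<omega>))) < card M"
  obtains J where "J \<subseteq> touching_pairs M" "card J = 2 * card M"
    "J \<inter> (\<lambda>e. \<pi> ` e) ` J = {}" "J \<union> (\<lambda>e. \<pi> ` e) ` J \<subseteq> matched \<omega>"
proof -
  define E where "E = edges \<omega>"
  define h where "h = (\<lambda>e. \<pi> ` e)"
  define m where "m = card M"
  have simple: "simple_graph V E" unfolding E_def by (rule edges_simple[OF \<omega>])
  note finE = simple_graph_finite(1)[OF simple] and E2 = simple_graph_finite(2)[OF simple]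
  have M_sub: "M \<subseteq> V" and finM: "finite M" using M finite_V by auto
  have inj: "inj \<pi>" using \<pi> by (rule permutes_inj)
  have inj_h: "inj_on h X" for X
    unfolding h_def using inj by (auto simp: inj_on_def inj_image_eq_iff)
  define EM where "EM = {e \<in> E. e \<inter> M \<noteq> {}}"
  have finEM: "finite EM" unfolding EM_def using finE by simp
  have EM_card: "d * m \<le> 2 * card EM"
    unfolding EM_def m_def
    by (rule card_incident_ge[OF simple finM])
       (use edges_regular[OF \<omega>] M_sub in \<open>auto simp: regular_graph_def E_def\<close>)
  \<comment> \<open>Four kinds of edges are discarded, at most \<open>m\<close> of each: those fixed
    by \<open>\<pi>\<close>, those in \<open>F\<close>, those sent into \<open>F\<close>, and those
    sent out of the graph. As \<open>d\<close> is at least 20, \<open>EM\<close> has at least 10 m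
    edges, so 6 m survive, and a third of them is the required 2 m.\<close>
  define B1 where "B1 = {e \<in> EM. h e = e}"
  define B2 where "B2 = {e \<in> F. e \<inter> M \<noteq> {}}"
  define B3 where "B3 = {e \<in> EM. h e \<in> B2}"
  define B4 where "B4 = {e \<in> EM. h e \<notin> E}"
  have B1_card: "card B1 \<le> m"
  proof -
    have "B1 \<subseteq> (\<lambda>u. {u, \<pi> u}) ` M"
    \<comment> \<open>An edge fixed as a set that contains a moved point \<open>u\<close> also
      contains its image, hence is determined by \<open>u\<close>.\<close>
    proof
      fix e assume e: "e \<in> B1"
      then obtain u where u: "u \<in> e" "u \<in> M" unfolding B1_def EM_def by auto
      have "\<pi> u \<in> e" using e u unfolding B1_def h_def by auto
      moreover have "\<pi> u \<noteq> u" using u M by auto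
      moreover have "card e = 2" using e E2 unfolding B1_def EM_def by auto
      ultimately have "e = {u, \<pi> u}" using u by (auto simp: card_2_iff)
      then show "e \<in> (\<lambda>u. {u, \<pi> u}) ` M" using u by simp
    qed
    then show ?thesis unfolding m_def using surj_card_le[OF finM] by blast
  qed
  have B2_card: "card B2 \<le> m"
    using card_incident_le[OF finite_F finM, of 1] F_degree M_sub
    unfolding B2_def m_def by auto
  have finB2: "finite B2" unfolding B2_def using finite_F by simp
  have B3_card: "card B3 \<le> m"
  proof -
    have "card B3 \<le> card B2"
      by (rule card_inj_on_le[OF inj_h _ finB2]) (auto simp: B3_def)
    then show ?thesis using B2_card by simp
  qed
  have B4_card: "card B4 \<le> m"
  proof -
    have "card B4 \<le> card (sym_diff E (permuted_edges \<pi> E))"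
    proof (rule card_inj_on_le[OF inj_h])
      show "h ` B4 \<subseteq> sym_diff E (permuted_edges \<pi> E)"
        unfolding permuted_edges_eq_image[OF simple] h_def[symmetric]
        by (auto simp: B4_def EM_def)
      show "finite (sym_diff E (permuted_edges \<pi> E))"
        unfolding permuted_edges_eq_image[OF simple] using finE by simp
    qed
    then show ?thesis using few unfolding E_def m_def by simp
  qed
  \<comment> \<open>For \<open>e \<in> X\<close>, \<open>e\<close> and \<open>\<pi> ` e\<close> are distinct edges, both from the random part.\<close>
  define X where "X = EM - (B1 \<union> B2 \<union> B3 \<union> B4)"
  have X_card: "6 * m \<le> card X"
  proof -
    have "card EM \<le> card (X \<union> (B1 \<union> B2 \<union> B3 \<union> B4))"
      unfolding X_def B1_def B3_def B4_def using finEM finB2 by (intro card_mono) auto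
    also have "\<dots> \<le> card X + (card B1 + card B2 + card B3 + card B4)"
      by (intro order_trans[OF card_Un_le] add_left_mono order_trans[OF card_Un_le] add_right_mono) simp
    finally have "card EM \<le> card X + 4 * m"
      using B1_card B2_card B3_card B4_card by simp
    moreover have "20 * m \<le> d * m" using d by (rule mult_right_mono) simp
    ultimately show ?thesis using EM_card by linarith
  qed
  have "finite X" unfolding X_def using finEM by simp
  moreover have "h e \<noteq> e" if "e \<in> X" for e using that unfolding X_def B1_def by auto
  ultimately obtain K where K: "K \<subseteq> X" "K \<inter> h ` K = {}" "card X \<le> 3 * card K"
    using disjoint_from_image_third[OF _ inj_h, of X] by blast
  have "2 * m \<le> card K" using K(3) X_card by simp
  then obtain J where J: "J \<subseteq> K" "card J = 2 * m" by (meson obtain_subset_with_card_n)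
  have "J \<inter> h ` J = {}" using J K by blast
  moreover have "J \<subseteq> touching_pairs M"
  proof
    fix e assume "e \<in> J"
    then have "e \<in> E" "e \<inter> M \<noteq> {}" using J K unfolding X_def EM_def by auto
    then obtain u where u: "u \<in> e" "u \<in> M" and e: "e \<subseteq> V" "card e = 2" using E2 by auto
    then obtain v where "e = {u, v}" by (auto simp: card_2_iff)
    then show "e \<in> touching_pairs M" using u e unfolding touching_pairs_def by force
  qed
  moreover have "J \<union> h ` J \<subseteq> matched \<omega>"
  proof -
    have "e \<in> matched \<omega> \<and> h e \<in> matched \<omega>" if "e \<in> J" for e
    proof -
      have e: "e \<in> E" "e \<inter> M \<noteq> {}" "e \<notin> B2" "h e \<notin> B2" "h e \<in> E"
        using that J K unfolding X_def B3_def B4_def EM_def by auto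
      obtain u where u: "u \<in> e" "u \<in> M" using e(2) by auto
      \<comment> \<open>Moved points go to moved points, so \<open>h e\<close> again meets
        \<open>M\<close>; since it is not in \<open>B2\<close>, it is not in
        \<open>F\<close>.\<close>
      have "\<pi> u \<in> M"
        using u(2) M \<pi> inj by (auto simp: permutes_in_image dest: injD)
      then have "h e \<inter> M \<noteq> {}" using u(1) unfolding h_def by auto
      with e show ?thesis unfolding E_def edges_def B2_def by auto
    qed
    then show ?thesis by auto
  qed
  ultimately show thesis using J(2) unfolding h_def m_def by (intro that)
qed

text \<open>With b = d + 2, the moved set and the permutation cost n^m, the choice of
  \<open>J\<close> costs (9/4 n^2)^m, and containment has probability at most (81 b^4 / n^4)^m. The
  product is (729/4 b^4 / n)^m, and 2000 exceeds 10 * 729/4.\<close>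

lemma robust_term_le:
  assumes n: "2000 * (d + 2) ^ 4 \<le> card V" and m: "0 < m"
  shows "real (card V choose m) * (fact m * real ((m * card V) choose (2 * m)) * (3 / real N) ^ (4 * m))
    \<le> (1 / 10) ^ m"
proof -
  define n where "n = real (card V)"
  define b where "b = real d + 2"
  have b: "0 < b" unfolding b_def by simp
  have "real (2000 * (d + 2) ^ 4) \<le> n" unfolding n_def using n of_nat_le_iff by blast
  then have n_ge: "2000 * b ^ 4 \<le> n" unfolding b_def by (simp add: add.commute)
  then have n_pos: "0 < n" using b by (smt (verit) zero_less_power)
  have "real (card V choose m) * fact m \<le> n ^ m"
    using binomial_fact_pow[of "card V" m] unfolding n_def
    by (metis of_nat_fact of_nat_le_iff of_nat_mult of_nat_power)
  moreover have "real ((m * card V) choose (2 * m)) \<le> (9 / 4 * n ^ 2) ^ m"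
  proof -
    have "real ((m * card V) choose (2 * m)) \<le> (3 * real (m * card V) / real (2 * m)) ^ (2 * m)"
      by (rule binomial_le_power_div)
    also have "3 * real (m * card V) / real (2 * m) = 3 / 2 * n"
      using m by (simp add: n_def)
    also have "(3 / 2 * n) ^ (2 * m) = (9 / 4 * n ^ 2) ^ m"
      by (simp add: power_mult power_mult_distrib power_divide)
    finally show ?thesis .
  qed
  moreover have "(3 / real N) ^ (4 * m) \<le> (81 * b ^ 4 / n ^ 4) ^ m"
  proof -
    have "(3 / real N) ^ (4 * m) \<le> (3 * b / n) ^ (4 * m)"
      using three_over_N_le unfolding n_def b_def by (intro power_mono) auto
    then show ?thesis by (simp add: power_mult power_mult_distrib power_divide)
  qed
  ultimately have "(real (card V choose m) * fact m) * real ((m * card V) choose (2 * m)) * (3 / real N) ^ (4 * m)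
      \<le> n ^ m * (9 / 4 * n ^ 2) ^ m * (81 * b ^ 4 / n ^ 4) ^ m"
    using n_pos by (intro mult_mono) auto
  also have "\<dots> = (n * (9 / 4 * n ^ 2) * (81 * b ^ 4 / n ^ 4)) ^ m"
    by (simp only: power_mult_distrib)
  also have "\<dots> \<le> (1 / 10) ^ m"
  proof (intro power_mono)
    have "n * (9 / 4 * n ^ 2) * (81 * b ^ 4 / n ^ 4) = 729 / 4 * b ^ 4 / n"
      using n_pos by (simp add: field_simps power2_eq_square power4_eq_xxxx)
    also have "\<dots> \<le> 1 / 10" using n_ge n_pos by (simp add: field_simps)
    finally show "n * (9 / 4 * n ^ 2) * (81 * b ^ 4 / n ^ 4) \<le> 1 / 10" .
  qed (use n_pos in auto)
  finally show ?thesis by (simp add: mult.assoc)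
qed

lemma card_not_robust_le:
  assumes d: "20 \<le> d" and n: "2000 * (d + 2) ^ 4 \<le> card V"
  shows "real (card {\<omega> \<in> \<Omega>. \<exists>\<pi>. \<pi> permutes V \<and>
      card (sym_diff (edges \<omega>) (permuted_edges \<pi> (edges \<omega>))) < card {v \<in> V. \<pi> v \<noteq> v}})
    \<le> real (card \<Omega>) * (1 / 9)"
proof -
  let ?h = "\<lambda>\<pi> e. \<pi> ` e :: 'a set"
  \<comment> \<open>A permutation with moved set \<open>M\<close> permutes \<open>M\<close> itself,
    so given \<open>M\<close> there are only (card M)! choices. Disjointness of \<open>J\<close>
    from its image yields 4 |M| distinct pairs, and avoiding \<open>F\<close> makes
    \<open>card_containing_le\<close> applicable to them.\<close>
  define T where "T M = {(\<pi>, J). \<pi> permutes M \<and> J \<subseteq> touching_pairs M \<and> card J = 2 * card M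
      \<and> J \<inter> ?h \<pi> ` J = {} \<and> (J \<union> ?h \<pi> ` J) \<inter> F = {}}" for M
  define ev where "ev = (\<lambda>(\<pi>, J). {\<omega> \<in> \<Omega>. J \<union> ?h \<pi> ` J \<subseteq> edges \<omega>})"
  have T_sub: "T M \<subseteq> {\<pi>. \<pi> permutes M} \<times> {J. J \<subseteq> touching_pairs M \<and> card J = 2 * card M}" for M
    unfolding T_def by auto
  have finP: "finite ({\<pi>. \<pi> permutes M} \<times> {J. J \<subseteq> touching_pairs M \<and> card J = 2 * card M})"
    if "M \<subseteq> V" for M
  proof -
    have "finite M" using that finite_V finite_subset by blast
    moreover have "finite {J. J \<subseteq> touching_pairs M \<and> card J = 2 * card M}"
      using card_touching_pairs_le(1)[OF that] by simp
    ultimately show ?thesis by (simp add: finite_permutations)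
  qed
  have T_card: "card (T M) \<le> fact (card M) * ((card M * card V) choose (2 * card M))"
    if "M \<subseteq> V" for M
  proof -
    have "card (T M) \<le> card ({\<pi>. \<pi> permutes M} \<times> {J. J \<subseteq> touching_pairs M \<and> card J = 2 * card M})"
      by (rule card_mono[OF finP[OF that] T_sub])
    also have "\<dots> = fact (card M) * (card (touching_pairs M) choose (2 * card M))"
      using finite_subset[OF that finite_V] card_touching_pairs_le(1)[OF that]
      by (simp add: card_cartesian_product card_permutations n_subsets)
    also have "\<dots> \<le> fact (card M) * ((card M * card V) choose (2 * card M))"
      by (intro mult_left_mono binomial_right_mono card_touching_pairs_le(2)[OF that]) simp
    finally show ?thesis .
  qed
  have ev_card: "real (card (ev p)) \<le> real (card \<Omega>) * (3 / real N) ^ (4 * card M)"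
    if M: "M \<subseteq> V" and "p \<in> T M" for M p
  proof -
    obtain \<pi> J where p: "p = (\<pi>, J)" by (cases p)
    with that have J: "\<pi> permutes M" "J \<subseteq> touching_pairs M" "card J = 2 * card M"
      "J \<inter> ?h \<pi> ` J = {}" "(J \<union> ?h \<pi> ` J) \<inter> F = {}" unfolding T_def by auto
    have finJ: "finite J" using J(2) card_touching_pairs_le(1)[OF M] finite_subset by blast
    have "inj_on (?h \<pi>) J"
      using permutes_inj[OF J(1)] by (auto simp: inj_on_def inj_image_eq_iff)
    then have "card (J \<union> ?h \<pi> ` J) = 4 * card M"
      using finJ J(3,4) by (simp add: card_Un_disjoint card_image)
    then show ?thesis
      using card_containing_le[OF _ J(5)] finJ unfolding ev_def p by simp
  qed
  have "{\<omega> \<in> \<Omega>. \<exists>\<pi>. \<pi> permutes V \<and>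
      card (sym_diff (edges \<omega>) (permuted_edges \<pi> (edges \<omega>))) < card {v \<in> V. \<pi> v \<noteq> v}}
    \<subseteq> (\<Union>M\<in>Pow V - {{}}. \<Union>p\<in>T M. ev p)" (is "?bad \<subseteq> _")
  proof
    fix \<omega> assume "\<omega> \<in> ?bad"
    then obtain \<pi> where \<omega>: "\<omega> \<in> \<Omega>" and \<pi>: "\<pi> permutes V"
      and few: "card (sym_diff (edges \<omega>) (permuted_edges \<pi> (edges \<omega>))) < card {v \<in> V. \<pi> v \<noteq> v}"
      by auto
    define M where "M = {v \<in> V. \<pi> v \<noteq> v}"
    obtain J where J: "J \<subseteq> touching_pairs M" "card J = 2 * card M"
      "J \<inter> ?h \<pi> ` J = {}" "J \<union> ?h \<pi> ` J \<subseteq> matched \<omega>"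
      using almost_invariant_witness[OF \<omega> d \<pi> M_def few[folded M_def]] by blast
    have "M \<noteq> {}" using few[folded M_def] by (cases "M = {}") simp_all
    then have "M \<in> Pow V - {{}}" unfolding M_def by auto
    moreover have "\<pi> permutes M"
      using \<pi> by (rule permutes_superset) (auto simp: M_def)
    then have "(\<pi>, J) \<in> T M"
      using J matched_disjoint_F[OF \<omega>] unfolding T_def by blast
    moreover have "\<omega> \<in> ev (\<pi>, J)"
      using J(4) \<omega> unfolding ev_def edges_def by auto
    ultimately show "\<omega> \<in> (\<Union>M\<in>Pow V - {{}}. \<Union>p\<in>T M. ev p)" by blast
  qed
  moreover have finev: "finite (ev p)" for p
    using finite_\<Omega> unfolding ev_def by (auto split: prod.splits)
  have finT: "finite (T M)" if "M \<subseteq> V" for M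
    using finP[OF that] T_sub by (rule rev_finite_subset)
  ultimately have "card ?bad \<le> card (\<Union>M\<in>Pow V - {{}}. \<Union>p\<in>T M. ev p)"
    using finite_V finT finev by (intro card_mono) auto
  also have "\<dots> \<le> (\<Sum>M\<in>Pow V - {{}}. card (\<Union>p\<in>T M. ev p))"
    using finite_V by (intro card_UN_le) auto
  also have "\<dots> \<le> (\<Sum>M\<in>Pow V - {{}}. \<Sum>p\<in>T M. card (ev p))"
    using finT by (intro sum_mono card_UN_le) auto
  finally have "real (card ?bad) \<le> real (\<Sum>M\<in>Pow V - {{}}. \<Sum>p\<in>T M. card (ev p))"
    by (rule of_nat_mono)
  also have "\<dots> = (\<Sum>M\<in>Pow V - {{}}. \<Sum>p\<in>T M. real (card (ev p)))" by simp
  also have "\<dots> \<le> (\<Sum>M\<in>Pow V - {{}}. real (card \<Omega>) *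
      (fact (card M) * real ((card M * card V) choose (2 * card M)) * (3 / real N) ^ (4 * card M)))"
  proof (intro sum_mono)
    fix M assume "M \<in> Pow V - {{}}"
    then have M: "M \<subseteq> V" by auto
    have "(\<Sum>p\<in>T M. real (card (ev p))) \<le> real (card (T M)) * (real (card \<Omega>) * (3 / real N) ^ (4 * card M))"
      using ev_card[OF M] by (intro sum_bounded_above) auto
    also have "\<dots> \<le> real (fact (card M) * ((card M * card V) choose (2 * card M)))
        * (real (card \<Omega>) * (3 / real N) ^ (4 * card M))"
      by (intro mult_right_mono of_nat_mono T_card[OF M]) auto
    finally show "(\<Sum>p\<in>T M. real (card (ev p))) \<le> real (card \<Omega>) *
      (fact (card M) * real ((card M * card V) choose (2 * card M)) * (3 / real N) ^ (4 * card M))"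
      by (simp add: mult_ac)
  qed
  also have "\<dots> = real (card \<Omega>) * (\<Sum>m = 1..card V. real (card V choose m) *
      (fact m * real ((m * card V) choose (2 * m)) * (3 / real N) ^ (4 * m)))"
    unfolding sum_distrib_left[symmetric] by (subst sum_Pow_card[OF finite_V]) (rule refl)
  also have "\<dots> \<le> real (card \<Omega>) * (\<Sum>m = 1..card V. (1 / 10) ^ m)"
    by (intro mult_left_mono sum_mono robust_term_le n) auto
  also have "\<dots> \<le> real (card \<Omega>) * (1 / 9)"
    by (intro mult_left_mono sum_tenth_powers_le) simp
  finally show ?thesis .
qed

text \<open>In terms of the density x = w/n, the term is at most the w-th power of (3/x) (81 x)^D =
  243 (81 x)^(D - 1). The constant 1296 = 81 * 16 makes 81 x at most 1/16, and already eight such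
  factors beat 243.\<close>

lemma small_term_le:
  assumes D: "9 \<le> D" "d \<le> 8 * D + 7" and w: "0 < w" "1296 * w \<le> card V"
  shows "real (card V choose w) * ((3 * real w / real D) ^ (w * D) * (3 / real N) ^ (w * D)) \<le> (1 / 10) ^ w"
proof -
  define n where "n = real (card V)"
  define x where "x = real w / n"
  have n_pos: "0 < n" using w unfolding n_def by simp
  have x_pos: "0 < x" using w n_pos unfolding x_def by simp
  have "real (1296 * w) \<le> n" using w(2) unfolding n_def of_nat_le_iff .
  then have x_le: "81 * x \<le> 1 / 16" unfolding x_def using n_pos by (simp add: field_simps)
  have "real (card V choose w) \<le> (3 / x) ^ w"
    using binomial_le_power_div[of "card V" w] by (simp add: x_def n_def)
  moreover have "(3 * real w / real D) ^ (w * D) * (3 / real N) ^ (w * D) \<le> ((81 * x) ^ D) ^ w"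
  proof -
    have "3 * real w / real D * (3 / real N) \<le> 3 * real w / real D * (3 * (real d + 2) / n)"
      using three_over_N_le unfolding n_def by (intro mult_left_mono) auto
    \<comment> \<open>Here d + 2 <= 8 D + 9 <= 9 D.\<close>
    also have "\<dots> \<le> 3 * real w / real D * (3 * (9 * real D) / n)"
      using D n_pos by (intro mult_left_mono divide_right_mono) auto
    also have "\<dots> = 81 * x" using D unfolding x_def by simp
    finally have "(3 * real w / real D * (3 / real N)) ^ (w * D) \<le> (81 * x) ^ (w * D)"
      by (intro power_mono) auto
    then show ?thesis by (simp only: power_mult_distrib power_mult mult.commute[of w D])
  qed
  ultimately have "real (card V choose w) * ((3 * real w / real D) ^ (w * D) * (3 / real N) ^ (w * D))
      \<le> (3 / x) ^ w * ((81 * x) ^ D) ^ w"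
    using x_pos by (intro mult_mono) auto
  also have "\<dots> = (3 / x * (81 * x) ^ D) ^ w" by (simp only: power_mult_distrib)
  also have "\<dots> \<le> (1 / 10) ^ w"
  proof (intro power_mono)
    have "3 / x * (81 * x) ^ D = 243 * (81 * x) ^ (D - 1)"
      using D(1) x_pos by (cases D) auto
    also have "\<dots> \<le> 243 * (1 / 16) ^ (D - 1)"
      using x_le x_pos by (intro mult_left_mono power_mono) auto
    also have "\<dots> \<le> 243 * (1 / 16) ^ 8"
      using D(1) by (intro mult_left_mono power_decreasing) auto
    also have "\<dots> \<le> (1 / 10 :: real)" by (simp add: power_divide)
    finally show "3 / x * (81 * x) ^ D \<le> 1 / 10" .
  qed (use x_pos in auto)
  finally show ?thesis .
qed

text \<open>Such a \<open>W\<close> spans at least d |W| / 4 edges, of which at most |W| come from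
  \<open>F\<close>. The others include D |W| random edges inside \<open>W\<close>, and the union
  bound runs over \<open>W\<close> and over the sets of that many pairs.\<close>

lemma card_small_dense_le:
  assumes d: "72 \<le> d"
  shows "real (card {\<omega> \<in> \<Omega>. \<exists>W \<subseteq> V. W \<noteq> {} \<and> 1296 * card W \<le> card V \<and>
      d * card W \<le> 4 * card {e \<in> edges \<omega>. e \<subseteq> W}}) \<le> real (card \<Omega>) * (1 / 9)"
proof -
  \<comment> \<open>Taking d/8 in place of d/4 leaves room for the edges of \<open>F\<close>: what
    is used is 4 D + 4 <= d.\<close>
  define D where "D = d div 8"
  have D: "9 \<le> D" "d \<le> 8 * D + 7" "8 * D \<le> d" using d unfolding D_def by auto
  define pairs where "pairs W = {e. e \<subseteq> W \<and> card e = 2}" for W :: "'a set"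
  define T where "T W = {J. J \<subseteq> pairs W \<and> card J = card W * D \<and> J \<inter> F = {}}" for W
  define ev where "ev J = {\<omega> \<in> \<Omega>. J \<subseteq> edges \<omega>}" for J
  define \<W> where "\<W> = {W \<in> Pow V - {{}}. 1296 * card W \<le> card V}"
  have fin: "finite W" if "W \<in> \<W>" for W
    using that finite_V finite_subset unfolding \<W>_def by auto
  have fin_pairs: "finite (pairs W)" if "W \<in> \<W>" for W
    using fin[OF that] unfolding pairs_def by simp
  have finT: "finite (T W)" if "W \<in> \<W>" for W
    using fin_pairs[OF that] unfolding T_def by simp
  have T_card: "real (card (T W)) \<le> (3 * real (card W) / real D) ^ (card W * D)" if "W \<in> \<W>" for W
  proof -
    have w: "0 < card W" using that fin[OF that] unfolding \<W>_def by (auto simp: card_gt_0_iff)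
    have "card (T W) \<le> card {J. J \<subseteq> pairs W \<and> card J = card W * D}"
      unfolding T_def using fin_pairs[OF that] by (intro card_mono) auto
    also have "\<dots> = card (pairs W) choose (card W * D)"
      by (rule n_subsets[OF fin_pairs[OF that]])
    finally have "real (card (T W)) \<le> real (card (pairs W) choose (card W * D))" by simp
    also have "\<dots> \<le> (3 * real (card (pairs W)) / real (card W * D)) ^ (card W * D)"
      by (rule binomial_le_power_div)
    also have "\<dots> \<le> (3 * real (card W * card W) / real (card W * D)) ^ (card W * D)"
    proof -
      have "card (pairs W) = card W choose 2"
        unfolding pairs_def by (rule n_subsets[OF fin[OF that]])
      also have "\<dots> \<le> card W * card W" by (simp add: choose_two div_le_mono order_trans[OF div_le_dividend])
      finally show ?thesis
        by (intro power_mono divide_right_mono mult_left_mono of_nat_mono) auto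
    qed
    also have "3 * real (card W * card W) / real (card W * D) = 3 * real (card W) / real D"
      using w by simp
    finally show ?thesis .
  qed
  have "{\<omega> \<in> \<Omega>. \<exists>W \<subseteq> V. W \<noteq> {} \<and> 1296 * card W \<le> card V \<and>
      d * card W \<le> 4 * card {e \<in> edges \<omega>. e \<subseteq> W}} \<subseteq> (\<Union>W\<in>\<W>. \<Union>J\<in>T W. ev J)" (is "?bad \<subseteq> _")
  proof
    fix \<omega> assume "\<omega> \<in> ?bad"
    then obtain W where \<omega>: "\<omega> \<in> \<Omega>" and W: "W \<subseteq> V" "W \<noteq> {}" "1296 * card W \<le> card V"
      and dense: "d * card W \<le> 4 * card {e \<in> edges \<omega>. e \<subseteq> W}" by auto
    have finW: "finite W" using W finite_V finite_subset by blast
    note simple = simple_graph_finite[OF edges_simple[OF \<omega>]]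
    have "card {e \<in> edges \<omega>. e \<subseteq> W} \<le> card ({e \<in> edges \<omega> - F. e \<subseteq> W} \<union> {e \<in> F. e \<inter> W \<noteq> {}})"
    proof (rule card_mono)
      show "{e \<in> edges \<omega>. e \<subseteq> W} \<subseteq> {e \<in> edges \<omega> - F. e \<subseteq> W} \<union> {e \<in> F. e \<inter> W \<noteq> {}}"
      proof
        fix e assume e: "e \<in> {e \<in> edges \<omega>. e \<subseteq> W}"
        then have "card e = 2" using simple(2) by auto
        then have "e \<noteq> {}" by (cases "e = {}") simp_all
        then have "e \<inter> W \<noteq> {}" using e by blast
        then show "e \<in> {e \<in> edges \<omega> - F. e \<subseteq> W} \<union> {e \<in> F. e \<inter> W \<noteq> {}}" using e by auto
      qed
    qed (use simple(1) finite_F in auto)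
    also have "\<dots> \<le> card {e \<in> edges \<omega> - F. e \<subseteq> W} + card {e \<in> F. e \<inter> W \<noteq> {}}"
      by (rule card_Un_le)
    also have "card {e \<in> F. e \<inter> W \<noteq> {}} \<le> card W"
      using card_incident_le[OF finite_F finW, of 1] F_degree W(1) by auto
    finally have "d * card W \<le> 4 * card {e \<in> edges \<omega> - F. e \<subseteq> W} + 4 * card W" using dense by simp
    moreover have "(4 * D + 4) * card W \<le> d * card W" using D by (intro mult_right_mono) auto
    ultimately have "card W * D \<le> card {e \<in> edges \<omega> - F. e \<subseteq> W}" by (simp add: algebra_simps)
    then obtain J where J: "J \<subseteq> {e \<in> edges \<omega> - F. e \<subseteq> W}" "card J = card W * D"
      by (meson obtain_subset_with_card_n)
    then have "J \<in> T W" using simple(2) unfolding T_def pairs_def by blast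
    moreover have "\<omega> \<in> ev J" using J \<omega> unfolding ev_def by auto
    moreover have "W \<in> \<W>" using W unfolding \<W>_def by auto
    ultimately show "\<omega> \<in> (\<Union>W\<in>\<W>. \<Union>J\<in>T W. ev J)" by blast
  qed
  moreover have finev: "finite (ev J)" for J using finite_\<Omega> unfolding ev_def by simp
  moreover have fin\<W>: "finite \<W>" using finite_V unfolding \<W>_def by simp
  ultimately have "card ?bad \<le> card (\<Union>W\<in>\<W>. \<Union>J\<in>T W. ev J)"
    using finT by (intro card_mono) auto
  also have "\<dots> \<le> (\<Sum>W\<in>\<W>. card (\<Union>J\<in>T W. ev J))"
    using fin\<W> by (intro card_UN_le) auto
  also have "\<dots> \<le> (\<Sum>W\<in>\<W>. \<Sum>J\<in>T W. card (ev J))"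
    using finT by (intro sum_mono card_UN_le) auto
  finally have "real (card ?bad) \<le> real (\<Sum>W\<in>\<W>. \<Sum>J\<in>T W. card (ev J))"
    by (rule of_nat_mono)
  also have "\<dots> = (\<Sum>W\<in>\<W>. \<Sum>J\<in>T W. real (card (ev J)))" by simp
  also have "\<dots> \<le> (\<Sum>W\<in>\<W>. real (card \<Omega>) *
      ((3 * real (card W) / real D) ^ (card W * D) * (3 / real N) ^ (card W * D)))"
  proof (intro sum_mono)
    fix W assume W: "W \<in> \<W>"
    have "(\<Sum>J\<in>T W. real (card (ev J))) \<le> real (card (T W)) * (real (card \<Omega>) * (3 / real N) ^ (card W * D))"
    proof (rule sum_bounded_above)
      fix J assume "J \<in> T W"
      then have J: "finite J" "J \<inter> F = {}" "card J = card W * D"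
        using fin_pairs[OF W] finite_subset unfolding T_def by auto
      show "real (card (ev J)) \<le> real (card \<Omega>) * (3 / real N) ^ (card W * D)"
        using card_containing_le[OF J(1,2)] J(3) unfolding ev_def by simp
    qed
    also have "\<dots> \<le> (3 * real (card W) / real D) ^ (card W * D) * (real (card \<Omega>) * (3 / real N) ^ (card W * D))"
      by (intro mult_right_mono T_card[OF W]) auto
    finally show "(\<Sum>J\<in>T W. real (card (ev J))) \<le> real (card \<Omega>) *
      ((3 * real (card W) / real D) ^ (card W * D) * (3 / real N) ^ (card W * D))"
      by (simp add: mult_ac)
  qed
  also have "\<dots> = real (card \<Omega>) * (\<Sum>W\<in>\<W>.
      (3 * real (card W) / real D) ^ (card W * D) * (3 / real N) ^ (card W * D))"
    unfolding sum_distrib_left ..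
  also have "(\<Sum>W\<in>\<W>. (3 * real (card W) / real D) ^ (card W * D) * (3 / real N) ^ (card W * D))
    = (\<Sum>W\<in>Pow V - {{}}. if 1296 * card W \<le> card V then
      (3 * real (card W) / real D) ^ (card W * D) * (3 / real N) ^ (card W * D) else 0)"
    unfolding \<W>_def using finite_V by (intro sum.inter_filter) auto
  also have "\<dots> = (\<Sum>w = 1..card V. real (card V choose w) * (if 1296 * w \<le> card V then
      (3 * real w / real D) ^ (w * D) * (3 / real N) ^ (w * D) else 0))"
    by (subst sum_Pow_card[OF finite_V]) (rule refl)
  also have "real (card \<Omega>) * \<dots> \<le> real (card \<Omega>) * (\<Sum>w = 1..card V. (1 / 10) ^ w)"
  proof (intro mult_left_mono sum_mono)
    fix w assume "w \<in> {1..card V}"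
    then show "real (card V choose w) * (if 1296 * w \<le> card V then
      (3 * real w / real D) ^ (w * D) * (3 / real N) ^ (w * D) else 0) \<le> (1 / 10) ^ w"
      using small_term_le[OF D(1,2), of w] by simp
  qed simp
  also have "\<dots> \<le> real (card \<Omega>) * (1 / 9)"
    by (intro mult_left_mono sum_tenth_powers_le) simp
  finally show ?thesis .
qed

text \<open>There are at most 4^n pairs of sets, while each has probability at most exp (- 4 n).
  Indeed |Q| >= n/3 >= (d + 1) N / 3 makes |Q| - 3 N at least 20736 N for large \<open>d\<close>;
  dividing by 2 N gives 10368 = 4 * 2592, and |S| >= n/2592.\<close>

lemma card_large_separated_le:
  assumes d: "100000 \<le> d"
  shows "real (card {\<omega> \<in> \<Omega>. \<exists>S \<subseteq> V. \<exists>Q \<subseteq> V. card V \<le> 2592 * card S \<and> card V \<le> 3 * card Q \<and>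
      (\<forall>x\<in>S. \<forall>y\<in>Q. {x, y} \<notin> edges \<omega>)}) \<le> real (card \<Omega>) * (1 / 4)"
proof -
  define n where "n = card V"
  have n_pos: "1 \<le> n" using card_V_ge N_pos d unfolding n_def by (metis One_nat_def Suc_leI add_gr_0 less_le_trans nat_0_less_mult_iff zero_less_one)
  define T where "T = {(S, Q). S \<subseteq> V \<and> Q \<subseteq> V \<and> n \<le> 2592 * card S \<and> n \<le> 3 * card Q}"
  define ev where "ev = (\<lambda>(S, Q). {\<omega> \<in> \<Omega>. \<forall>x\<in>S. \<forall>y\<in>Q. {x, y} \<notin> edges \<omega>})"
  have T_sub: "T \<subseteq> Pow V \<times> Pow V" unfolding T_def by auto
  have finT: "finite T" using T_sub finite_V by (meson finite_Pow_iff finite_SigmaI finite_subset)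
  have "card T \<le> card (Pow V \<times> Pow V)" using T_sub finite_V by (intro card_mono) auto
  also have "\<dots> = 4 ^ n"
    using finite_V by (simp add: card_cartesian_product card_Pow n_def flip: power_mult_distrib)
  finally have T_card: "real (card T) \<le> 4 ^ n" by (metis of_nat_le_iff of_nat_numeral of_nat_power)
  have ev_card: "real (card (ev p)) \<le> real (card \<Omega>) * exp (- (4 * real n))" if "p \<in> T" for p
  proof -
    obtain S Q where p: "p = (S, Q)" by (cases p)
    with that have SQ: "S \<subseteq> V" "Q \<subseteq> V" "n \<le> 2592 * card S" "n \<le> 3 * card Q"
      unfolding T_def by auto
    have "real ((d + 1) * N) \<le> real (3 * card Q)"
      using SQ(4) card_V_ge unfolding n_def by (intro of_nat_mono) simp
    moreover have "100000 * real N \<le> real d * real N" using d by (intro mult_right_mono) auto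
    ultimately have "20736 * real N \<le> real (card Q) - 3 * real N" by (simp add: algebra_simps)
    then have "10368 \<le> (real (card Q) - 3 * real N) / (2 * real N)"
      using N_pos by (simp add: field_simps)
    then have "real (card S) * 10368 \<le> real (card S) * ((real (card Q) - 3 * real N) / (2 * real N))"
      by (intro mult_left_mono) auto
    moreover have "4 * real n \<le> real (card S) * 10368" using SQ(3) by simp
    ultimately have "exp (- (real (card S) * (real (card Q) - 3 * real N) / (2 * real N))) \<le> exp (- (4 * real n))"
      by simp
    then have "real (card \<Omega>) * exp (- (real (card S) * (real (card Q) - 3 * real N) / (2 * real N)))
        \<le> real (card \<Omega>) * exp (- (4 * real n))"
      by (intro mult_left_mono) auto
    then show ?thesis
      using card_no_edges_between_le[OF SQ(1,2)] unfolding ev_def p by simp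
  qed
  have "{\<omega> \<in> \<Omega>. \<exists>S \<subseteq> V. \<exists>Q \<subseteq> V. card V \<le> 2592 * card S \<and> card V \<le> 3 * card Q \<and>
      (\<forall>x\<in>S. \<forall>y\<in>Q. {x, y} \<notin> edges \<omega>)} = (\<Union>p\<in>T. ev p)" (is "?bad = _")
    unfolding T_def ev_def n_def by auto
  then have "card ?bad \<le> (\<Sum>p\<in>T. card (ev p))"
    using card_UN_le[OF finT] by simp
  then have "real (card ?bad) \<le> real (\<Sum>p\<in>T. card (ev p))" by (rule of_nat_mono)
  also have "\<dots> \<le> real (card T) * (real (card \<Omega>) * exp (- (4 * real n)))"
    unfolding of_nat_sum by (intro sum_bounded_above ev_card)
  also have "\<dots> \<le> 4 ^ n * (real (card \<Omega>) * exp (- (4 * real n)))"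
    by (intro mult_right_mono T_card) auto
  also have "\<dots> = real (card \<Omega>) * (4 * exp (- 4)) ^ n"
    by (simp add: power_mult_distrib exp_of_nat_mult[symmetric] mult_ac)
  also have "\<dots> \<le> real (card \<Omega>) * (1 / 4)"
  proof (intro mult_left_mono)
    have "16 \<le> exp (4 :: real)"
    proof -
      have "(2 :: real) \<le> exp 1" using exp_ge_add_one_self[of 1] by simp
      then have "(2 :: real) ^ 4 \<le> exp 1 ^ 4" by (intro power_mono) auto
      then show ?thesis by (simp flip: exp_of_nat_mult)
    qed
    then have le: "4 * exp (- 4 :: real) \<le> 1 / 4" by (simp add: exp_minus field_simps)
    have "(4 * exp (- 4 :: real)) ^ n \<le> (4 * exp (- 4)) ^ 1"
      using n_pos le by (intro power_decreasing) auto
    then show "(4 * exp (- 4 :: real)) ^ n \<le> 1 / 4" using le by simp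
  qed simp
  finally show ?thesis .
qed

text \<open>The three bad events have total probability at most 1/9 + 1/9 + 1/4 < 1. An outcome
  outside them is robust by the first, and the other two exclude every set with too few outer
  neighbours.\<close>

lemma exists_robust_expander:
  assumes d: "100000 \<le> d" and n: "2000 * (d + 2) ^ 4 \<le> card V"
  shows "\<exists>E. regular_graph d V E \<and> vertex_expander (1 / 3) V E \<and> robustly_self_ordered 1 V E"
proof -
  define B1 where "B1 = {\<omega> \<in> \<Omega>. \<exists>\<pi>. \<pi> permutes V \<and>
      card (sym_diff (edges \<omega>) (permuted_edges \<pi> (edges \<omega>))) < card {v \<in> V. \<pi> v \<noteq> v}}"
  define B2 where "B2 = {\<omega> \<in> \<Omega>. \<exists>W \<subseteq> V. W \<noteq> {} \<and> 1296 * card W \<le> card V \<and>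
      d * card W \<le> 4 * card {e \<in> edges \<omega>. e \<subseteq> W}}"
  define B3 where "B3 = {\<omega> \<in> \<Omega>. \<exists>S \<subseteq> V. \<exists>Q \<subseteq> V. card V \<le> 2592 * card S \<and> card V \<le> 3 * card Q \<and>
      (\<forall>x\<in>S. \<forall>y\<in>Q. {x, y} \<notin> edges \<omega>)}"
  have "card (B1 \<union> B2 \<union> B3) \<le> card B1 + card B2 + card B3"
    using card_Un_le[of "B1 \<union> B2" B3] card_Un_le[of B1 B2] by linarith
  then have "real (card (B1 \<union> B2 \<union> B3)) \<le> real (card B1) + real (card B2) + real (card B3)"
    by linarith
  also have "\<dots> \<le> real (card \<Omega>) * (1 / 9) + real (card \<Omega>) * (1 / 9) + real (card \<Omega>) * (1 / 4)"
    unfolding B1_def B2_def B3_def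
    using d n by (intro add_mono card_not_robust_le card_small_dense_le card_large_separated_le) auto
  also have "\<dots> < real (card \<Omega>)" using card_\<Omega>_pos by simp
  finally have less: "card (B1 \<union> B2 \<union> B3) < card \<Omega>" by simp
  have "finite (B1 \<union> B2 \<union> B3)"
    using finite_\<Omega> unfolding B1_def B2_def B3_def by simp
  then have "\<not> \<Omega> \<subseteq> B1 \<union> B2 \<union> B3"
    using card_mono[of "B1 \<union> B2 \<union> B3" \<Omega>] less by linarith
  then obtain \<omega> where \<omega>: "\<omega> \<in> \<Omega>" and good: "\<omega> \<notin> B1" "\<omega> \<notin> B2" "\<omega> \<notin> B3" by auto
  have reg: "regular_graph d V (edges \<omega>)" by (rule edges_regular[OF \<omega>])
  have simple: "simple_graph V (edges \<omega>)" by (rule edges_simple[OF \<omega>])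
  have "robustly_self_ordered 1 V (edges \<omega>)"
    using good(1) \<omega> unfolding B1_def robustly_self_ordered_def by (auto simp: not_less)
  moreover have "vertex_expander (1 / 3) V (edges \<omega>)"
    unfolding vertex_expander_def
  proof (intro allI impI, elim conjE)
    fix S assume S: "S \<subseteq> V" and half: "real (card S) \<le> real (card V) / 2"
    define T where "T = {v \<in> V - S. \<exists>u\<in>S. {u, v} \<in> edges \<omega>}"
    show "1 / 3 * real (card S) \<le> real (card {v \<in> V - S. \<exists>u\<in>S. {u, v} \<in> edges \<omega>})"
    proof (rule ccontr)
      assume "\<not> ?thesis"
      then have less: "3 * card T < card S" unfolding T_def by simp
      define W where "W = S \<union> T"
      have finS: "finite S" using S finite_V finite_subset by blast
      have finT: "finite T" and disj: "S \<inter> T = {}" and WV: "W \<subseteq> V"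
        using S finite_V unfolding T_def W_def by auto
      have cW: "card W = card S + card T"
        unfolding W_def using finS finT disj by (rule card_Un_disjoint)
      have closed: "v \<in> W" if "u \<in> S" "{u, v} \<in> edges \<omega>" for u v
      proof -
        have "v \<in> V" using that simple_graph_finite(2)[OF simple] by auto
        then show ?thesis using that unfolding W_def T_def by auto
      qed
      \<comment> \<open>All edges meeting \<open>S\<close> lie inside \<open>W\<close>, and |W| <= 2
        |S|, so \<open>W\<close> is as dense as in \<open>B2\<close>. Since that event fails,
        \<open>W\<close>, and with it \<open>S\<close>, has linear size.\<close>
      have "d * card S \<le> 2 * card {e \<in> edges \<omega>. e \<inter> S \<noteq> {}}"
        by (rule card_incident_ge[OF simple finS]) (use reg S in \<open>auto simp: regular_graph_def\<close>)
      also have "card {e \<in> edges \<omega>. e \<inter> S \<noteq> {}} \<le> card {e \<in> edges \<omega>. e \<subseteq> W}"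
      proof (rule card_mono)
        show "{e \<in> edges \<omega>. e \<inter> S \<noteq> {}} \<subseteq> {e \<in> edges \<omega>. e \<subseteq> W}"
        proof
          fix e assume "e \<in> {e \<in> edges \<omega>. e \<inter> S \<noteq> {}}"
          then obtain u where e: "e \<in> edges \<omega>" "u \<in> e" "u \<in> S" by auto
          then have "card e = 2" using simple_graph_finite(2)[OF simple] by auto
          then obtain v where "e = {u, v}" using e(2) by (auto simp: card_2_iff)
          then show "e \<in> {e \<in> edges \<omega>. e \<subseteq> W}" using e closed[of u v] unfolding W_def by auto
        qed
      qed (use simple_graph_finite(1)[OF simple] in auto)
      finally have dense: "d * card S \<le> 2 * card {e \<in> edges \<omega>. e \<subseteq> W}" by simp
      have "card W \<le> 2 * card S" using cW less by simp
      then have "d * card W \<le> 2 * (d * card S)"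
        using mult_le_mono2[of "card W" "2 * card S" d] by (simp only: mult.left_commute)
      then have dense': "d * card W \<le> 4 * card {e \<in> edges \<omega>. e \<subseteq> W}" using dense by linarith
      have "W \<noteq> {}" using less unfolding W_def by auto
      have "card V < 1296 * card W"
      proof (rule ccontr)
        assume "\<not> ?thesis"
        then have "1296 * card W \<le> card V" by simp
        then have "\<omega> \<in> B2"
          unfolding B2_def using \<omega> WV \<open>W \<noteq> {}\<close> dense' by blast
        with good(2) show False by contradiction
      qed
      then have "card V \<le> 2592 * card S" using \<open>card W \<le> 2 * card S\<close> by simp
      \<comment> \<open>Here |W| is at most 4/3 |S|, hence at most 2/3 of the vertices; the rest has
        no edge to \<open>S\<close>, contradicting the choice of an outcome outside
        \<open>B3\<close>.\<close>
      moreover have "card V \<le> 3 * card (V - W)"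
      proof -
        have "card (V - W) = card V - card W"
          using WV finite_V by (intro card_Diff_subset) (auto intro: finite_subset)
        moreover have "2 * card S \<le> card V" using half by simp
        ultimately show ?thesis using cW less by simp
      qed
      moreover have "\<forall>x\<in>S. \<forall>y\<in>V - W. {x, y} \<notin> edges \<omega>" using closed by auto
      ultimately show False using good(3) \<omega> S unfolding B3_def by blast
    qed
  qed
  ultimately show ?thesis using reg by blast
qed

end

subsection \<open>Lifts of complete graphs\<close>

lemma mult_add_less_mult: "i * N + a < j * N" if "i < j" "a < N" for i j N a :: nat
proof -
  have "i * N + N \<le> j * N" using mult_le_mono1[of "Suc i" j N] that(1) by simp
  then show ?thesis using that(2) by simp
qed

text \<open>Shifting by \<open>t\<close> from \<open>k\<close> on enumerates
  \<open>{..<N + t}\<close> with one block of length \<open>t\<close> left out, which is how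
  \<open>upper\<close> omits the block of a class.\<close>

lemma skip_block_iff:
  fixes k t N z :: nat
  assumes "k \<le> N" "z < N + t"
  shows "(\<exists>b<N. z = (if k \<le> b then b + t else b)) \<longleftrightarrow> \<not> (k \<le> z \<and> z < k + t)"
proof
  assume "\<not> (k \<le> z \<and> z < k + t)"
  then consider "z < k" | "k + t \<le> z" by linarith
  then show "\<exists>b<N. z = (if k \<le> b then b + t else b)"
  proof cases
    case 1
    then show ?thesis using assms by (intro exI[of _ z]) auto
  next
    case 2
    then show ?thesis using assms by (intro exI[of _ "z - t"]) auto
  qed
qed (auto split: if_splits)

text \<open>A random lift of the complete graph on \<open>{0..d}\<close>, adapted to \<open>n = (d + 1) N + t\<close> vertices.
  Part \<open>i < d\<close> is \<open>{i N..<(i + 1) N}\<close>, while part \<open>d\<close> has \<open>N + t\<close> vertices. The matching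
  between the parts \<open>i\<close> and \<open>d\<close> omits the \<open>i\<close>-th block of \<open>t\<close> vertices of part \<open>d\<close>, and the
  \<open>d t\<close> omitted vertices are paired up among themselves by the fixed edges; this is where
  \<open>n d\<close> being even is needed.\<close>

locale uneven_lift =
  fixes d N t :: nat
  assumes d_pos: "0 < d" and t_le: "t \<le> d" and N_ge: "d * d \<le> N" and even_dt: "even (d * t)"
begin

definition classes :: "(nat \<times> nat) set" where
  "classes = {(i, j). i < j \<and> j \<le> d}"

definition lower :: "nat \<times> nat \<Rightarrow> nat \<Rightarrow> nat" where
  "lower = (\<lambda>(i, j) a. i * N + a)"

definition upper :: "nat \<times> nat \<Rightarrow> nat \<Rightarrow> nat" where
  "upper = (\<lambda>(i, j) b. j * N + (if j = d \<and> i * t \<le> b then b + t else b))"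

definition extra :: "nat set set" where
  "extra = {{d * N + 2 * l, d * N + 2 * l + 1} | l. 2 * l + 1 < d * t}"

section \<open>Arithmetic of the parts and the omitted blocks\<close>

lemma N_pos: "0 < N"
proof -
  have "0 < d * d" using d_pos by simp
  then show ?thesis using N_ge by (rule less_le_trans)
qed

lemma dt_le: "d * t \<le> N"
  by (rule order_trans[OF mult_le_mono2[OF t_le] N_ge])

lemma it_le: "i \<le> d \<Longrightarrow> i * t \<le> N"
  by (rule order_trans[OF mult_le_mono1 dt_le])

lemma it_t_le: "i < d \<Longrightarrow> i * t + t \<le> d * t"
  using mult_le_mono1[of "Suc i" d t] by simp

lemma t_le_N: "t \<le> N"
  using it_t_le[OF d_pos] dt_le by linarith

lemma lower_less: "(i, j) \<in> classes \<Longrightarrow> a < N \<Longrightarrow> lower (i, j) a < j * N"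
  unfolding lower_def classes_def by (auto intro: mult_add_less_mult)

lemma upper_ge: "j * N \<le> upper (i, j) b"
  unfolding upper_def by simp

lemma upper_less:
  assumes "b < N" "j < d"
  shows "upper (i, j) b < Suc j * N"
  using assms unfolding upper_def by simp

lemma part_cases:
  assumes "v < (d + 1) * N + t"
  obtains (small) i a where "i < d" "a < N" "v = i * N + a"
    | (large) z where "z < N + t" "v = d * N + z"
proof (cases "v < d * N")
  case True
  have "v div N < d" using True by (simp add: less_mult_imp_div_less)
  moreover have "v mod N < N" using N_pos by simp
  moreover have "v = v div N * N + v mod N" by simp
  ultimately show thesis by (rule small)
next
  case False
  then show thesis using assms large[of "v - d * N"] by simp
qed

lemma part_eq_iff:
  assumes "a < N" "a' < N"
  shows "i * N + a = i' * N + a' \<longleftrightarrow> i = i' \<and> a = a'"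
proof
  assume eq: "i * N + a = i' * N + a'"
  from arg_cong[OF this, of "\<lambda>x. x div N"] have "i = i'" using assms by simp
  then show "i = i' \<and> a = a'" using eq by simp
qed simp

lemma part_ex_iff: "a < N \<Longrightarrow> (\<exists>x<N. i * N + a = k * N + x) \<longleftrightarrow> k = i"
  by (auto simp: part_eq_iff)

lemma in_lower_iff: "v \<in> lower (i, j) ` {..<N} \<longleftrightarrow> (\<exists>a<N. v = i * N + a)"
  unfolding lower_def by auto

lemma in_upper_small_iff:
  assumes "j < d"
  shows "v \<in> upper (i, j) ` {..<N} \<longleftrightarrow> (\<exists>b<N. v = j * N + b)"
  using assms unfolding upper_def by auto

lemma in_upper_large_iff:
  assumes "i < d" "z < N + t"
  shows "d * N + z \<in> upper (i, d) ` {..<N} \<longleftrightarrow> \<not> (i * t \<le> z \<and> z < i * t + t)"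
proof -
  have "d * N + z \<in> upper (i, d) ` {..<N} \<longleftrightarrow> (\<exists>b<N. z = (if i * t \<le> b then b + t else b))"
    unfolding upper_def by auto
  then show ?thesis using skip_block_iff[of "i * t" N z t] it_le[of i] assms by simp
qed

text \<open>The \<open>lower\<close> end is the smaller number, so the unordered pair determines
  both ends. Division by \<open>N\<close> recovers \<open>i\<close> and \<open>a\<close> from the
  lower end; the part containing the upper end gives \<open>j\<close>, and then \<open>b\<close>
  follows because the skipping map is injective.\<close>

lemma pair_classes_inj:
  "inj_on (\<lambda>(c, a, b). {lower c a, upper c b}) (classes \<times> {..<N} \<times> {..<N})"
proof (rule inj_onI)
  fix p q assume p: "p \<in> classes \<times> {..<N} \<times> {..<N}" and q: "q \<in> classes \<times> {..<N} \<times> {..<N}"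
    and eq: "(\<lambda>(c, a, b). {lower c a, upper c b}) p = (\<lambda>(c, a, b). {lower c a, upper c b}) q"
  obtain i j a b where pe: "p = ((i, j), a, b)" by (cases p) auto
  obtain i' j' a' b' where qe: "q = ((i', j'), a', b')" by (cases q) auto
  have cl: "(i, j) \<in> classes" "(i', j') \<in> classes" and ab: "a < N" "b < N" "a' < N" "b' < N"
    using p q pe qe by auto
  have "lower (i, j) a < upper (i, j) b" "lower (i', j') a' < upper (i', j') b'"
    using lower_less[OF cl(1) ab(1)] lower_less[OF cl(2) ab(3)] upper_ge[of j i b] upper_ge[of j' i' b']
    by linarith+
  moreover have "{lower (i, j) a, upper (i, j) b} = {lower (i', j') a', upper (i', j') b'}"
    using eq pe qe by simp
  ultimately have low: "lower (i, j) a = lower (i', j') a'" and up: "upper (i, j) b = upper (i', j') b'"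
    by (auto simp: doubleton_eq_iff)
  have ia: "i = i'" "a = a'" using low part_eq_iff[OF ab(1,3)] unfolding lower_def by auto
  \<comment> \<open>The parts are consecutive intervals and the longer part \<open>d\<close> comes
    last, so its extra vertices overlap no other part.\<close>
  have not_less: False if "k < l" "l \<le> d" "upper (i, k) x = upper (i, l) y" "x < N" for k l x y
  proof -
    have "upper (i, k) x < Suc k * N" using that by (intro upper_less) auto
    also have "\<dots> \<le> l * N" using that(1) by (intro mult_le_mono1) simp
    also have "\<dots> \<le> upper (i, l) y" by (rule upper_ge)
    finally show False using that(3) by simp
  qed
  have "j \<le> d" "j' \<le> d" using cl unfolding classes_def by auto
  then have "j = j'"
    using not_less[of j j' b b'] not_less[of j' j b' b] up ab ia by (metis linorder_neqE_nat)
  then have "b = b'" using up ia unfolding upper_def by (auto split: if_splits)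
  with ia \<open>j = j'\<close> show "p = q" using pe qe by simp
qed

lemma degree_extra: "degree extra v = (if d * N \<le> v \<and> v < d * N + d * t then 1 else 0)"
proof (cases "d * N \<le> v \<and> v < d * N + d * t")
  case True
  then obtain z where z: "v = d * N + z" "z < d * t" by (metis le_add_diff_inverse nat_add_left_cancel_less)
  define l where "l = z div 2"
  \<comment> \<open>By evenness of d t, even the last omitted vertex has a partner.\<close>
  have "2 * l + 1 < d * t"
  proof -
    obtain m where m: "d * t = 2 * m" using even_dt by (rule evenE)
    then have "l < m" using z unfolding l_def by auto
    then show ?thesis using m by simp
  qed
  then have in_extra: "{d * N + 2 * l, d * N + 2 * l + 1} \<in> extra" unfolding extra_def by auto
  have "{e \<in> extra. v \<in> e} = {{d * N + 2 * l, d * N + 2 * l + 1}}"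
  proof (intro equalityI subsetI)
    fix e assume "e \<in> {e \<in> extra. v \<in> e}"
    then obtain l' where e: "e = {d * N + 2 * l', d * N + 2 * l' + 1}" and "v \<in> e"
      unfolding extra_def by auto
    then have "z = 2 * l' \<or> z = 2 * l' + 1" using z(1) by auto
    then have "l' = l" unfolding l_def by auto
    then show "e \<in> {{d * N + 2 * l, d * N + 2 * l + 1}}" using e by simp
  next
    fix e assume "e \<in> {{d * N + 2 * l, d * N + 2 * l + 1}}"
    moreover have "z = 2 * l \<or> z = 2 * l + 1" unfolding l_def by linarith
    ultimately show "e \<in> {e \<in> extra. v \<in> e}" using in_extra z(1) by auto
  qed
  then show ?thesis using True unfolding degree_def by simp
next
  case False
  then have "{e \<in> extra. v \<in> e} = {}" unfolding extra_def by auto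
  then have "degree extra v = 0" unfolding degree_def by (simp only: card.empty)
  then show ?thesis using False by auto
qed

text \<open>A vertex of part \<open>i\<close> is at the lower end in the d - i classes (i, j) and at
  the upper end in the \<open>i\<close> classes (k, i).\<close>

lemma class_count_small:
  assumes "i < d" "a < N"
  shows "card {c \<in> classes. i * N + a \<in> lower c ` {..<N} \<union> upper c ` {..<N}} = d"
proof -
  have "{c \<in> classes. i * N + a \<in> lower c ` {..<N} \<union> upper c ` {..<N}}
      = Pair i ` {i<..d} \<union> (\<lambda>k. (k, i)) ` {..<i}" (is "?L = ?R")
  proof (intro set_eqI)
    fix c :: "nat \<times> nat"
    obtain k j where c: "c = (k, j)" by (cases c)
    show "c \<in> ?L \<longleftrightarrow> c \<in> ?R"
    proof (cases "(k, j) \<in> classes")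
      case False
      then show ?thesis using c assms unfolding classes_def by auto
    next
      case True
      have low: "i * N + a \<in> lower (k, j) ` {..<N} \<longleftrightarrow> k = i"
        unfolding in_lower_iff by (rule part_ex_iff[OF assms(2)])
      have "i * N + a < d * N" by (rule mult_add_less_mult[OF assms])
      then have "i * N + a \<notin> upper (k, d) ` {..<N}"
        using upper_ge[of d k] by (metis imageE not_less)
      moreover have "i * N + a \<in> upper (k, j) ` {..<N} \<longleftrightarrow> j = i" if "j < d"
        unfolding in_upper_small_iff[OF that] by (rule part_ex_iff[OF assms(2)])
      ultimately have up: "i * N + a \<in> upper (k, j) ` {..<N} \<longleftrightarrow> j = i"
        using True assms unfolding classes_def by (cases "j = d") auto
      show ?thesis unfolding c using True low up unfolding classes_def by auto
    qed
  qed
  moreover have "card ?R = card (Pair i ` {i<..d}) + card ((\<lambda>k. (k, i)) ` {..<i})"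
    by (rule card_Un_disjoint) auto
  moreover have "\<dots> = d" using assms by (simp add: card_image inj_on_def)
  ultimately show ?thesis by simp
qed

text \<open>The blocks tile the first d t positions of part \<open>d\<close>, so a vertex there is
  omitted by exactly one class; its edge in \<open>extra\<close> makes up for the loss.\<close>

lemma class_count_large:
  assumes z: "z < N + t"
  shows "card {c \<in> classes. d * N + z \<in> lower c ` {..<N} \<union> upper c ` {..<N}}
    = (if z < d * t then d - 1 else d)"
proof -
  let ?O = "{i \<in> {..<d}. i * t \<le> z \<and> z < i * t + t}"
  have "{c \<in> classes. d * N + z \<in> lower c ` {..<N} \<union> upper c ` {..<N}}
      = (\<lambda>i. (i, d)) ` ({..<d} - ?O)" (is "?L = ?R")
  proof (intro set_eqI)
    fix c :: "nat \<times> nat"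
    obtain k j where c: "c = (k, j)" by (cases c)
    show "c \<in> ?L \<longleftrightarrow> c \<in> ?R"
    proof (cases "(k, j) \<in> classes")
      case False
      then show ?thesis using c assms unfolding classes_def by auto
    next
      case True
      then have kj: "k < j" "j \<le> d" unfolding classes_def by auto
      have "lower (k, j) x < d * N" if "x < N" for x
        using lower_less[OF True that] mult_le_mono1[OF kj(2), of N] by linarith
      then have low: "d * N + z \<notin> lower (k, j) ` {..<N}" by fastforce
      show ?thesis
      proof (cases "j = d")
        case True
        then show ?thesis using c kj low in_upper_large_iff[of k z] z unfolding classes_def by auto
      next
        case False
        then have "j < d" using kj by simp
        have "upper (k, j) x < d * N" if "x < N" for x
          using upper_less[OF that \<open>j < d\<close>, of k] mult_le_mono1[of "Suc j" d N] \<open>j < d\<close> by linarith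
        then have "d * N + z \<notin> upper (k, j) ` {..<N}" by fastforce
        then show ?thesis using c low False by auto
      qed
    qed
  qed
  moreover have "card ?R = card ({..<d} - ?O)" by (intro card_image) (auto simp: inj_on_def)
  moreover have "\<dots> = d - card ?O" by (subst card_Diff_subset) auto
  moreover have "card ?O = (if z < d * t then 1 else 0)"
  proof (cases "z < d * t")
    case True
    then have t: "0 < t" by (cases t) auto
    have "?O = {z div t}"
    proof (intro equalityI subsetI)
      fix i assume "i \<in> ?O"
      then have "i * t \<le> z" "z < Suc i * t" by auto
      then have "z div t = i" by (metis div_nat_eqI mult.commute)
      then show "i \<in> {z div t}" by simp
    next
      fix i assume "i \<in> {z div t}"
      then have i: "i = z div t" by simp
      have "i < d" unfolding i using True by (simp add: less_mult_imp_div_less)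
      moreover have "i * t + z mod t = z" unfolding i by (rule div_mult_mod_eq)
      moreover have "z mod t < t" using t by simp
      ultimately show "i \<in> ?O" unfolding mem_Collect_eq lessThan_iff by linarith
    qed
    then show ?thesis using True by simp
  next
    case False
    then have "?O = {}" using it_t_le by force
    then show ?thesis using False by simp
  qed
  ultimately show ?thesis by simp
qed

section \<open>Pairs of vertices that some matching may join\<close>

definition covered :: "nat \<Rightarrow> nat \<Rightarrow> bool" where
  "covered x y \<longleftrightarrow> (\<exists>c\<in>classes. \<exists>a<N. \<exists>b<N. {x, y} = {lower c a, upper c b})"

lemma covered_commute: "covered x y \<longleftrightarrow> covered y x"
  unfolding covered_def by (simp add: insert_commute)

lemma covered_small:
  assumes "i < j" "j < d" "a < N" "b < N"
  shows "covered (i * N + a) (j * N + b)"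
  unfolding covered_def
  by (rule bexI[of _ "(i, j)"], rule exI[of _ a], rule conjI, fact, rule exI[of _ b])
     (use assms in \<open>auto simp: lower_def upper_def classes_def\<close>)

lemma covered_large:
  assumes "i < d" "a < N" "z < N + t" "\<not> (i * t \<le> z \<and> z < i * t + t)"
  shows "covered (i * N + a) (d * N + z)"
proof -
  obtain b where "b < N" "d * N + z = upper (i, d) b"
    using in_upper_large_iff[of i z] assms by auto
  then show ?thesis
    unfolding covered_def
    by (intro bexI[of _ "(i, d)"] exI[of _ a] conjI exI[of _ b])
       (use assms in \<open>auto simp: lower_def classes_def\<close>)
qed

text \<open>A vertex of a part i < d misses its own part and the \<open>i\<close>-th block, N + t
  vertices. A vertex of part \<open>d\<close> misses its own part and at most the one part whose
  class omits it, 2 N + t vertices.\<close>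

lemma card_uncovered_le:
  assumes "x < (d + 1) * N + t"
  shows "card {y \<in> {..<(d + 1) * N + t}. \<not> covered x y} \<le> 3 * N"
  using assms
proof (cases x rule: part_cases)
  case (small i a)
  have "{y \<in> {..<(d + 1) * N + t}. \<not> covered x y}
      \<subseteq> {i * N..<i * N + N} \<union> {d * N + i * t..<d * N + i * t + t}"
  proof clarify
    fix y assume y: "y < (d + 1) * N + t" "\<not> covered x y"
      "y \<notin> {d * N + i * t..<d * N + i * t + t}"
    from y(1) show "y \<in> {i * N..<i * N + N}"
    proof (cases y rule: part_cases)
      case (small k b)
      then have "k = i"
        using covered_small[of i k a b] covered_small[of k i b a] covered_commute y(2)
          \<open>x = i * N + a\<close> \<open>i < d\<close> \<open>a < N\<close> by (metis linorder_neqE_nat)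
      then show ?thesis using small by simp
    next
      case (large z)
      then have "covered x y" using covered_large[of i a z] small y(3) by auto
      with y(2) show ?thesis by contradiction
    qed
  qed
  then have "card {y \<in> {..<(d + 1) * N + t}. \<not> covered x y}
      \<le> card ({i * N..<i * N + N} \<union> {d * N + i * t..<d * N + i * t + t})"
    by (intro card_mono) auto
  also have "\<dots> \<le> N + t" by (rule order_trans[OF card_Un_le]) simp
  finally show ?thesis using t_le_N by simp
next
  case (large z)
  \<comment> \<open>If no block contains \<open>z\<close>, for instance when \<open>t = 0\<close>,
    the second interval merely enlarges the bound.\<close>
  have "{y \<in> {..<(d + 1) * N + t}. \<not> covered x y}
      \<subseteq> {d * N..<d * N + N + t} \<union> {z div t * N..<z div t * N + N}"
  proof clarify
    fix y assume y: "y < (d + 1) * N + t" "\<not> covered x y"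
      "y \<notin> {z div t * N..<z div t * N + N}"
    from y(1) show "y \<in> {d * N..<d * N + N + t}"
    proof (cases y rule: part_cases)
      case (small k b)
      have "\<not> (k * t \<le> z \<and> z < k * t + t)"
      proof
        assume "k * t \<le> z \<and> z < k * t + t"
        then have "z div t = k" by (metis add.commute div_nat_eqI mult.commute mult_Suc)
        with small y(3) show False by simp
      qed
      then have "covered y x" using covered_large[of k b z] small large by simp
      with y(2) show ?thesis using covered_commute by blast
    next
      case (large z')
      then show ?thesis by simp
    qed
  qed
  then have "card {y \<in> {..<(d + 1) * N + t}. \<not> covered x y}
      \<le> card ({d * N..<d * N + N + t} \<union> {z div t * N..<z div t * N + N})"
    by (intro card_mono) auto
  also have "\<dots> \<le> (N + t) + N" by (rule order_trans[OF card_Un_le]) simp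
  finally show ?thesis using t_le_N by simp
qed

sublocale matching_model "{..<(d + 1) * N + t}" classes N d lower upper extra
proof
  show "finite classes"
    by (rule finite_subset[of _ "{..d} \<times> {..d}"]) (auto simp: classes_def)
  show "0 < N" by (rule N_pos)
  fix c a assume c: "c \<in> classes" and a: "a < N"
  obtain i j where ij: "c = (i, j)" by (cases c)
  then have j: "j \<le> d" using c by (simp add: classes_def)
  have jN: "j * N \<le> d * N" using j by (rule mult_le_mono1)
  have low: "lower c a < j * N" using lower_less c a ij by simp
  have size: "(d + 1) * N + t = d * N + (N + t)" by simp
  show "lower c a \<in> {..<(d + 1) * N + t}"
    unfolding size lessThan_iff using low jN by linarith
  have "upper c a \<le> j * N + (a + t)" using ij unfolding upper_def by auto
  then show "upper c a \<in> {..<(d + 1) * N + t}"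
    unfolding size lessThan_iff using a jN by linarith
  show "lower c a \<noteq> upper c b" for b using low upper_ge[of j i b] ij by simp
  show "{lower c a, upper c b} \<notin> extra" for b
  proof
    assume "{lower c a, upper c b} \<in> extra"
    then have "d * N \<le> lower c a" unfolding extra_def by (auto simp: doubleton_eq_iff)
    then show False using low jN by linarith
  qed
next
  show "inj_on (\<lambda>(c, a, b). {lower c a, upper c b}) (classes \<times> {..<N} \<times> {..<N})"
    by (rule pair_classes_inj)
  show "simple_graph {..<(d + 1) * N + t} extra"
    unfolding simple_graph_def
  proof (intro conjI ballI)
    fix e assume "e \<in> extra"
    then obtain l where "e = {d * N + 2 * l, d * N + 2 * l + 1}" "2 * l + 1 < d * t"
      unfolding extra_def by auto
    then show "\<exists>u v. u \<in> {..<(d + 1) * N + t} \<and> v \<in> {..<(d + 1) * N + t} \<and> u \<noteq> v \<and> e = {u, v}"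
      using dt_le by (intro exI[of _ "d * N + 2 * l"] exI[of _ "d * N + 2 * l + 1"]) auto
  qed simp
  show "(d + 1) * N \<le> card {..<(d + 1) * N + t}" by simp
  show "card {..<(d + 1) * N + t} \<le> (d + 2) * N" using t_le_N by simp
  fix v :: nat assume v: "v \<in> {..<(d + 1) * N + t}"
  show "degree extra v \<le> 1" by (simp add: degree_extra)
  show "card {y \<in> {..<(d + 1) * N + t}. \<forall>c\<in>classes. \<forall>a<N. \<forall>b<N. {v, y} \<noteq> {lower c a, upper c b}} \<le> 3 * N"
    using card_uncovered_le[of v] v unfolding covered_def by simp
  from v have "v < (d + 1) * N + t" by simp
  then show "card {c \<in> classes. v \<in> lower c ` {..<N} \<union> upper c ` {..<N}} + degree extra v = d"
  proof (cases v rule: part_cases)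
    case (small i a)
    then have "degree extra v = 0" using mult_add_less_mult[of i d a N] by (simp add: degree_extra)
    then show ?thesis using class_count_small[OF small(1,2)] small(3) by simp
  next
    case (large z)
    then show ?thesis using class_count_large[OF large(1)] d_pos by (simp add: degree_extra)
  qed
qed

end

section \<open>Connected circulant graphs for the small vertex numbers\<close>

lemma exists_connected_regular:
  assumes d: "2 \<le> d" and n: "d < n" and ev: "even (n * d)"
  shows "\<exists>E. regular_graph d {..<n} E \<and> vertex_expander (1 / real n) {..<n} E"
proof -
  \<comment> \<open>A circulant graph: \<open>D\<close> is a set of \<open>d\<close> differences, symmetric modulo \<open>n\<close> and containing 1.\<close>
  define h where "h = d div 2"
  define D where "D = {1..h} \<union> {n - h..<n} \<union> (if odd d then {n div 2} else {})"
  have h: "1 \<le> h" "2 * h \<le> d" unfolding h_def using d by auto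
  \<comment> \<open>For odd \<open>d\<close> the number \<open>n\<close> is even, and n/2 is its own
    negative modulo \<open>n\<close>, so it supplies the single missing difference; d < n keeps it
    away from both intervals.\<close>
  have half: "2 * (n div 2) = n \<and> h < n div 2 \<and> d = 2 * h + 1" if "odd d"
  proof -
    have "even n" "d = 2 * h + 1" using ev that unfolding h_def by auto
    then show ?thesis using n by auto
  qed
  have D_less: "0 < \<delta> \<and> \<delta> < n" if "\<delta> \<in> D" for \<delta>
    using that h n half unfolding D_def by (auto split: if_splits)
  have D_sym: "n - \<delta> \<in> D" if "\<delta> \<in> D" for \<delta>
    using that h n half unfolding D_def by (auto split: if_splits)
  have D_card: "card D = d"
  proof -
    have "card ({1..h} \<union> {n - h..<n}) = 2 * h"
      using h n by (subst card_Un_disjoint) auto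
    moreover have "card D = card ({1..h} \<union> {n - h..<n}) + (if odd d then 1 else 0)"
      using half n unfolding D_def by (subst card_Un_disjoint) auto
    ultimately show ?thesis using half unfolding h_def by auto
  qed
  define E where "E = {{u, v} | u v. u < v \<and> v < n \<and> v - u \<in> D}"
  have "simple_graph {..<n} E"
    unfolding simple_graph_def
  proof (intro conjI ballI)
    fix e assume "e \<in> E"
    then obtain u v where "e = {u, v}" "u < v" "v < n" unfolding E_def by auto
    then show "\<exists>u v. u \<in> {..<n} \<and> v \<in> {..<n} \<and> u \<noteq> v \<and> e = {u, v}"
      by (intro exI[of _ u] exI[of _ v]) auto
  qed simp
  moreover have "degree E x = d" if x: "x < n" for x
  proof -
    let ?s = "\<lambda>\<delta>. if x + \<delta> < n then x + \<delta> else x + \<delta> - n"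
    have inj: "inj_on (\<lambda>\<delta>. {x, ?s \<delta>}) D"
    proof (rule inj_onI)
      fix \<delta> \<epsilon> assume "\<delta> \<in> D" "\<epsilon> \<in> D" and eq: "{x, ?s \<delta>} = {x, ?s \<epsilon>}"
      then have "?s \<delta> = ?s \<epsilon>" by (auto simp: doubleton_eq_iff)
      then show "\<delta> = \<epsilon>" using D_less[OF \<open>\<delta> \<in> D\<close>] D_less[OF \<open>\<epsilon> \<in> D\<close>] x by (auto split: if_splits)
    qed
    have "{e \<in> E. x \<in> e} = (\<lambda>\<delta>. {x, ?s \<delta>}) ` D"
    proof (intro equalityI subsetI)
      fix e assume "e \<in> {e \<in> E. x \<in> e}"
      then obtain u v where uv: "e = {u, v}" "u < v" "v < n" "v - u \<in> D" "x \<in> e"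
        unfolding E_def by auto
      then consider "x = u" | "x = v" by auto
      then show "e \<in> (\<lambda>\<delta>. {x, ?s \<delta>}) ` D"
      proof cases
        case 1
        then show ?thesis using uv by (intro image_eqI[of _ _ "v - u"]) auto
      next
        case 2
        then show ?thesis using uv D_sym[OF uv(4)]
          by (intro image_eqI[of _ _ "n - (v - u)"]) (auto simp: insert_commute)
      qed
    next
      fix e assume "e \<in> (\<lambda>\<delta>. {x, ?s \<delta>}) ` D"
      then obtain \<delta> where \<delta>: "\<delta> \<in> D" "e = {x, ?s \<delta>}" by auto
      show "e \<in> {e \<in> E. x \<in> e}"
      proof (cases "x + \<delta> < n")
        case True
        then have "e = {x, x + \<delta>}" "x < x + \<delta>" "x + \<delta> - x \<in> D" using \<delta> D_less by auto
        then show ?thesis using True unfolding E_def by blast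
      next
        case False
        then have "e = {x + \<delta> - n, x}" "x + \<delta> - n < x" "x - (x + \<delta> - n) = n - \<delta>"
          using \<delta> D_less[OF \<delta>(1)] by auto
        then show ?thesis using x D_sym[OF \<delta>(1)] unfolding E_def by force
      qed
    qed
    then show ?thesis unfolding degree_def using card_image[OF inj] D_card by simp
  qed
  ultimately have "regular_graph d {..<n} E" unfolding regular_graph_def by simp
  \<comment> \<open>Connectedness suffices: a nonempty \<open>S\<close> of at most n/2 vertices has
    at least one outer neighbour, while |S| / n is at most 1. The difference 1 provides a
    Hamiltonian path, along which membership in an \<open>S\<close> without outer neighbours would
    propagate to every vertex.\<close>
  moreover have "vertex_expander (1 / real n) {..<n} E"
    unfolding vertex_expander_def
  proof (intro allI impI, elim conjE)
    fix S assume S: "S \<subseteq> {..<n}" and half: "real (card S) \<le> real (card {..<n}) / 2"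
    let ?T = "{v \<in> {..<n} - S. \<exists>u\<in>S. {u, v} \<in> E}"
    show "1 / real n * real (card S) \<le> real (card ?T)"
    proof (cases "S = {}")
      case False
      have step: "{k, Suc k} \<in> E" if "Suc k < n" for k
        using that h(1) unfolding E_def D_def by (intro CollectI exI[of _ k] exI[of _ "Suc k"]) auto
      have "?T \<noteq> {}"
      proof
        assume none: "?T = {}"
        have iff: "k \<in> S \<longleftrightarrow> Suc k \<in> S" if "Suc k < n" for k
        proof -
          have "{k, Suc k} \<in> E" "{Suc k, k} \<in> E"
            using step[OF that] by (simp_all add: insert_commute)
          moreover have "k < n" using that by simp
          ultimately show ?thesis using none that by blast
        qed
        have "k < n \<Longrightarrow> k \<in> S \<longleftrightarrow> 0 \<in> S" for k
          by (induction k) (use iff in auto)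
        then have "S = {..<n}" using S False by auto
        then show False using half n by simp
      qed
      then have "1 \<le> card ?T" by (simp add: Suc_le_eq card_gt_0_iff)
      moreover have "1 / real n * real (card S) \<le> 1"
        using card_mono[OF _ S] n by simp
      ultimately show ?thesis by linarith
    qed simp
  qed
  ultimately show ?thesis by blast
qed

section \<open>Assembling the family\<close>

lemma vertex_expander_mono:
  assumes "vertex_expander \<beta> V E" "\<beta>' \<le> \<beta>"
  shows "vertex_expander \<beta>' V E"
  using assms unfolding vertex_expander_def by (meson mult_right_mono of_nat_0_le_iff order_trans)

lemma exists_robust_regular_expander:
  assumes d: "100000 \<le> d" and n: "2000 * (d + 2) ^ 4 \<le> n" and ev: "even (n * d)"
  shows "\<exists>E. regular_graph d {..<n} E \<and> vertex_expander (1 / 3) {..<n} E \<and>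
    robustly_self_ordered 1 {..<n} E"
proof -
  define N t where "N = n div (d + 1)" and "t = n mod (d + 1)"
  have n_eq: "n = (d + 1) * N + t" unfolding N_def t_def by (rule mult_div_mod_eq[symmetric])
  \<comment> \<open>This gives d^2 (d + 1) <= n, so that the quotient \<open>N\<close> is large
    enough for the blocks to fit.\<close>
  have "d * d * (d + 1) \<le> (d + 2) * (d + 2) * (d + 2) * (d + 2)"
  proof -
    have "d * d * (d + 1) * 1 \<le> (d + 2) * (d + 2) * (d + 2) * (d + 2)"
      by (intro mult_le_mono) auto
    then show ?thesis by simp
  qed
  also have "\<dots> = (d + 2) ^ 4" by (simp only: power4_eq_xxxx)
  also have "\<dots> \<le> n" using n by simp
  finally have "d * d \<le> N" unfolding N_def by (simp add: less_eq_div_iff_mult_less_eq)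
  moreover have "even (d * t)"
  proof -
    \<comment> \<open>As d (d + 1) is even, d t has the parity of n d.\<close>
    have "n * d = (d + 1) * d * N + d * t" unfolding n_eq by (simp add: algebra_simps)
    moreover have "even ((d + 1) * d * N)" by simp
    ultimately show ?thesis using ev by presburger
  qed
  moreover have "t \<le> d" unfolding t_def using mod_less_divisor[of "d + 1" n] by simp
  ultimately interpret uneven_lift d N t using d by unfold_locales auto
  show ?thesis using exists_robust_expander d n unfolding n_eq by simp
qed

theorem theorem4p1:
  shows "\<exists>d0::nat. \<forall>d\<ge>d0. \<exists>\<gamma>>0. \<exists>\<beta>>0. \<exists>n0. \<exists>E :: nat \<Rightarrow> nat set set.
    \<forall>n. n > d \<and> even (n * d) \<longrightarrow>
      regular_graph d {..<n} (E n) \<and>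
      vertex_expander \<beta> {..<n} (E n) \<and>
      (n \<ge> n0 \<longrightarrow> robustly_self_ordered \<gamma> {..<n} (E n))"
proof (rule exI[of _ 100000], intro allI impI)
  fix d :: nat assume d: "100000 \<le> d"
  \<comment> \<open>From \<open>n0\<close> on, the random graph gives robustness with constant 1.
    Small \<open>n\<close> cannot be included: for n = d + 1 the only \<open>d\<close>-regular graph
    is complete and invariant under every permutation. Below \<open>n0\<close> the expansion 1/n is
    at least 1/n0, hence the minimum in \<open>\<beta>\<close>.\<close>
  define n0 where "n0 = 2000 * (d + 2) ^ 4"
  define \<beta> where "\<beta> = min (1 / 3) (1 / real n0)"
  have "0 < n0" unfolding n0_def by simp
  then have \<beta>: "0 < \<beta>" unfolding \<beta>_def by simp
  have "\<exists>E. n > d \<and> even (n * d) \<longrightarrow> regular_graph d {..<n} E \<and> vertex_expander \<beta> {..<n} E \<and>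
      (n \<ge> n0 \<longrightarrow> robustly_self_ordered 1 {..<n} E)" for n
  proof (cases "n > d \<and> even (n * d)")
    case True
    show ?thesis
    proof (cases "n0 \<le> n")
      case large: True
      then obtain E where "regular_graph d {..<n} E" "vertex_expander (1 / 3) {..<n} E"
        "robustly_self_ordered 1 {..<n} E"
        using exists_robust_regular_expander[OF d] True unfolding n0_def by blast
      moreover from this have "vertex_expander \<beta> {..<n} E"
        unfolding \<beta>_def by (auto intro: vertex_expander_mono)
      ultimately show ?thesis by blast
    next
      case False
      obtain E where "regular_graph d {..<n} E" "vertex_expander (1 / real n) {..<n} E"
        using exists_connected_regular[of d n] True d by auto
      moreover have "\<beta> \<le> 1 / real n"
        unfolding \<beta>_def using False True by (intro min.coboundedI2 divide_left_mono) auto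
      ultimately show ?thesis using False vertex_expander_mono by blast
    qed
  qed auto
  then obtain E :: "nat \<Rightarrow> nat set set" where "\<forall>n. n > d \<and> even (n * d) \<longrightarrow>
      regular_graph d {..<n} (E n) \<and> vertex_expander \<beta> {..<n} (E n) \<and>
      (n \<ge> n0 \<longrightarrow> robustly_self_ordered 1 {..<n} (E n))"
    by metis
  with \<beta> show "\<exists>\<gamma>>0. \<exists>\<beta>>0. \<exists>n0. \<exists>E :: nat \<Rightarrow> nat set set.
    \<forall>n. n > d \<and> even (n * d) \<longrightarrow>
      regular_graph d {..<n} (E n) \<and>
      vertex_expander \<beta> {..<n} (E n) \<and>
      (n \<ge> n0 \<longrightarrow> robustly_self_ordered \<gamma> {..<n} (E n))"
    by (intro exI[of _ 1] exI[of _ \<beta>] exI[of _ n0] exI[of _ E] conjI) auto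
qed

end
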